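(* The free group of rank 2 has positive density in the set of two-generator subgroups of Thompson's group $V$. That is, for each $n\ge 1$ let $\mathrm{Sph}_2(n)$ be the set of ordered pairs $(D_1,D_2)$ of fully marked tree pair diagrams, each of size $n$, and let $U$ be the set of pairs $(D_1,D_2)$ of fully marked tree pair diagrams such that the subgroup of $V$ generated by the two elements represented by $D_1$ and $D_2$ is isomorphic to the free group of rank 2. Then the limit $$\lim_{n\to\infty}\frac{|U\cap \mathrm{Sph}_2(n)|}{|\mathrm{Sph}_2(n)|}$$ exists and is positive.
   Context: Trees are finite rooted binary trees in which every internal node has an ordered left child and right child. A tree has size $n$ if it has $n$ internal nodes; it then has $n+1$ leaves, numbered $0,\dots,n$ from left to right. A tree determines a subdivision of $[0,1)$ into half-open dyadic intervals, one per leaf: the root corresponds to $[0,1)$, and if a node corresponds to $[a,b)$ then its left and right children correspond to $[a,\frac{a+b}{2})$ and $[\frac{a+b}{2},b)$. Identify $S^1$ with $[0,1)$, i.e. with $\mathbb{R}/\mathbb{Z}$. Thompson's group $V$ is the group of right-continuous piecewise-linear bijections of $S^1=\mathbb{R}/\mathbb{Z}$ which map dyadic rationals to dyadic rationals, whose slopes, where defined, are powers of $2$, and whose (finitely many) breakpoints and discontinuities lie in the dyadic rationals $\mathbb{Z}[\frac12]$. A fully marked tree pair diagram of size $n$ is a triple $(S,R,\pi)$ where $S$ (source) and $R$ (target) are trees of size $n$ and $\pi$ is a bijection from the leaves of $S$ to the leaves of $R$. The element of $V$ it represents maps the interval of each leaf of $S$ onto the interval of the corresponding leaf of $R$ by the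 increasing affine map. There are $(n+1)!\,C_n^2$ such diagrams of size $n$, where $C_n=\frac{1}{n+1}\binom{2n}{n}$. Diagrams are not required to be reduced; all diagrams are counted, so the same element of $V$ may be represented by many diagrams. *)

theory Defs
  imports
    Complex_Main
    "HOL-Library.Tree"
    "HOL-Combinatorics.Permutations"
    "HOL-Algebra.Bij"
    "HOL-Algebra.Generated_Groups"
begin

section \<open>Free groups\<close>

text \<open>The free group on \<open>A\<close> is the group of reduced words in the letters
  \<open>(a, True)\<close>, standing for \<open>a\<close>, and \<open>(a, False)\<close>, standing for the inverse of \<open>a\<close>.\<close>

definition inv_letter :: "'a \<times> bool \<Rightarrow> 'a \<times> bool" where
  "inv_letter x = (fst x, \<not> snd x)"

definition reduced :: "('a \<times> bool) list \<Rightarrow> bool" where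
  "reduced w \<longleftrightarrow> successively (\<lambda>x y. y \<noteq> inv_letter x) w"

fun push_letter :: "'a \<times> bool \<Rightarrow> ('a \<times> bool) list \<Rightarrow> ('a \<times> bool) list" where
  "push_letter x [] = [x]"
| "push_letter x (y # w) = (if y = inv_letter x then w else x # y # w)"

definition reduced_words :: "'a set \<Rightarrow> ('a \<times> bool) list set" where
  "reduced_words A = {w. reduced w \<and> fst ` set w \<subseteq> A}"

text \<open>For reduced words \<open>u\<close> and \<open>v\<close>, \<open>foldr push_letter u v\<close> is the reduced form
  of the concatenation \<open>u @ v\<close>.\<close>

definition free_group :: "'a set \<Rightarrow> ('a \<times> bool) list monoid" where
  "free_group A = \<lparr>carrier = reduced_words A, mult = foldr push_letter, one = []\<rparr>"

lemma inv_letter_inv_letter [simp]: "inv_letter (inv_letter x) = x"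
  by (simp add: inv_letter_def)

lemma inv_letter_neq [simp]: "inv_letter x \<noteq> x" "x \<noteq> inv_letter x"
  by (auto simp: inv_letter_def prod_eq_iff)

lemma reduced_ConsD: "reduced (x # w) \<Longrightarrow> reduced w"
  by (cases w) (auto simp: reduced_def)

lemma reduced_push_letter: "reduced w \<Longrightarrow> reduced (push_letter x w)"
  by (cases w) (auto simp: reduced_def successively_Cons)

lemma set_push_letter: "set (push_letter x w) \<subseteq> insert x (set w)"
  by (cases w) auto

lemma push_letter_inv: "reduced w \<Longrightarrow> push_letter x (push_letter (inv_letter x) w) = w"
  by (cases w; cases "tl w") (auto simp: reduced_def)

lemma push_letter_reduced: "reduced (x # w) \<Longrightarrow> push_letter x w = x # w"
  by (cases w) (auto simp: reduced_def)

lemma reduced_foldr_push: "reduced v \<Longrightarrow> reduced (foldr push_letter u v)"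
  by (induction u) (auto simp: reduced_push_letter)

lemma set_foldr_push: "set (foldr push_letter u v) \<subseteq> set u \<union> set v"
  using set_push_letter by (induction u) fastforce+

lemma foldr_push_push:
  "reduced w \<Longrightarrow> foldr push_letter (push_letter x u) w = push_letter x (foldr push_letter u w)"
  using push_letter_inv[OF reduced_foldr_push, of w x] by (cases u) auto

lemma foldr_push_assoc:
  "reduced w \<Longrightarrow>
    foldr push_letter (foldr push_letter u v) w = foldr push_letter u (foldr push_letter v w)"
  by (induction u) (auto simp: foldr_push_push)

lemma foldr_push_Nil: "reduced u \<Longrightarrow> foldr push_letter u [] = u"
proof (induction u)
  case (Cons x u)
  then show ?case
    using reduced_ConsD[of x u] push_letter_reduced[of x u] by simp
qed simp

lemma foldr_push_inverse:
  "reduced v \<Longrightarrow> foldr push_letter (rev (map inv_letter u)) (foldr push_letter u v) = v"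
proof (induction u arbitrary: v)
  case (Cons x u)
  then show ?case
    using push_letter_inv[OF reduced_foldr_push[OF Cons.prems], of "inv_letter x" u] by simp
qed simp

lemma reduced_rev_inv:
  assumes "reduced u"
  shows "reduced (rev (map inv_letter u))"
proof -
  have "successively (\<lambda>x y. inv_letter x \<noteq> inv_letter (inv_letter y)) u"
    using assms unfolding reduced_def
    by (rule successively_mono) (metis inv_letter_inv_letter)
  then show ?thesis
    by (simp add: reduced_def successively_map)
qed

lemma group_free_group: "group (free_group A)"
proof (rule groupI)
  fix u v assume "u \<in> carrier (free_group A)" "v \<in> carrier (free_group A)"
  then have "reduced (foldr push_letter u v)" "fst ` (set u \<union> set v) \<subseteq> A"
    by (simp_all add: free_group_def reduced_words_def reduced_foldr_push image_Un)
  moreover have "fst ` set (foldr push_letter u v) \<subseteq> fst ` (set u \<union> set v)"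
    by (rule image_mono) (rule set_foldr_push)
  ultimately show "u \<otimes>\<^bsub>free_group A\<^esub> v \<in> carrier (free_group A)"
    unfolding free_group_def reduced_words_def by simp
next
  show "\<one>\<^bsub>free_group A\<^esub> \<in> carrier (free_group A)"
    by (simp add: free_group_def reduced_words_def reduced_def)
next
  fix u assume u: "u \<in> carrier (free_group A)"
  then have u': "reduced u" "fst ` set u \<subseteq> A"
    by (simp_all add: free_group_def reduced_words_def)
  let ?v = "rev (map inv_letter u)"
  have "fst ` set ?v = fst ` set u"
    by (simp add: image_image inv_letter_def)
  then have "?v \<in> carrier (free_group A)"
    using u' reduced_rev_inv[of u] by (simp add: free_group_def reduced_words_def)
  moreover have "foldr push_letter ?v (foldr push_letter u []) = []"
    by (rule foldr_push_inverse) (simp add: reduced_def)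
  then have "?v \<otimes>\<^bsub>free_group A\<^esub> u = \<one>\<^bsub>free_group A\<^esub>"
    using foldr_push_Nil[OF u'(1)] by (simp add: free_group_def)
  ultimately show "\<exists>v\<in>carrier (free_group A). v \<otimes>\<^bsub>free_group A\<^esub> u = \<one>\<^bsub>free_group A\<^esub>"
    by blast
next
  fix u v w
  assume "u \<in> carrier (free_group A)" "v \<in> carrier (free_group A)" "w \<in> carrier (free_group A)"
  then show "u \<otimes>\<^bsub>free_group A\<^esub> v \<otimes>\<^bsub>free_group A\<^esub> w = u \<otimes>\<^bsub>free_group A\<^esub> (v \<otimes>\<^bsub>free_group A\<^esub> w)"
    by (simp add: free_group_def reduced_words_def foldr_push_assoc)
next
  fix u
  show "\<one>\<^bsub>free_group A\<^esub> \<otimes>\<^bsub>free_group A\<^esub> u = u"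
    by (simp add: free_group_def)
qed


section \<open>Thompson's group \<open>V\<close>\<close>

definition dyadic :: "real set" where
  "dyadic = {of_int m / 2 ^ k | (m :: int) (k :: nat). True}"

text \<open>The circle is represented by \<open>{0..<1}\<close>.  Both its topology and its affine structure are
  those of \<open>\<real>/\<int>\<close>: right-continuity is tested after composing with the embedding
  \<open>y \<mapsto> cis (2 * pi * y)\<close> into the unit circle, and affine maps are taken modulo 1.
  The finite set \<open>B\<close> contains the breakpoints and the discontinuities.\<close>

definition thompson_V_set :: "(real \<Rightarrow> real) set" where
  "thompson_V_set = {f \<in> Bij {0..<1}.
     (\<forall>a\<in>{0..<1}. continuous (at_right a) (\<lambda>x. cis (2 * pi * f x))) \<and>
     (\<forall>x\<in>dyadic \<inter> {0..<1}. f x \<in> dyadic) \<and>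
     (\<exists>B. finite B \<and> B \<subseteq> dyadic \<and>
       (\<forall>a b. {a<..<b} \<subseteq> {0..<1} - B \<longrightarrow>
         (\<exists>(k :: int) c. \<forall>x\<in>{a<..<b}. f x = frac (2 powi k * x + c))))}"

definition thompson_V :: "(real \<Rightarrow> real) monoid" where
  "thompson_V = BijGroup {0..<1} \<lparr>carrier := thompson_V_set\<rparr>"


section \<open>Fully marked tree pair diagrams\<close>

text \<open>A \<open>unit tree\<close> is a plain binary tree shape, and \<open>size\<close> counts its internal nodes.
  The list \<open>leaf_intervals a b t\<close> consists of the pairs of endpoints of the half-open intervals
  attached to the leaves of \<open>t\<close>, from left to right, when the root corresponds to \<open>{a..<b}\<close>.\<close>

fun leaf_intervals :: "real \<Rightarrow> real \<Rightarrow> unit tree \<Rightarrow> (real \<times> real) list" where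
  "leaf_intervals a b Leaf = [(a, b)]"
| "leaf_intervals a b (Node l _ r) =
     leaf_intervals a ((a + b) / 2) l @ leaf_intervals ((a + b) / 2) b r"

lemma length_leaf_intervals: "length (leaf_intervals a b t) = size t + 1"
  by (induction a b t rule: leaf_intervals.induct) auto

definition leaf_interval :: "unit tree \<Rightarrow> nat \<Rightarrow> real \<times> real" where
  "leaf_interval t i = leaf_intervals 0 1 t ! i"

type_synonym diagram = "unit tree \<times> unit tree \<times> (nat \<Rightarrow> nat)"

text \<open>The bijection between the leaves is a permutation of the leaf numbers \<open>0, \<dots>, n\<close>.
  Since \<open>permutes\<close> demands the identity elsewhere, each bijection is represented exactly once.\<close>

definition diagrams :: "nat \<Rightarrow> diagram set" where
  "diagrams n = {(S, R, p). size S = n \<and> size R = n \<and> p permutes {0..n}}"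

definition diagram_map :: "diagram \<Rightarrow> real \<Rightarrow> real" where
  "diagram_map = (\<lambda>(S, R, p). \<lambda>x\<in>{0..<1}. THE y. \<exists>i\<le>size S.
     let (a, b) = leaf_interval S i; (c, d) = leaf_interval R (p i)
     in x \<in> {a..<b} \<and> y = c + (x - a) * ((d - c) / (b - a)))"

definition Sph2 :: "nat \<Rightarrow> (diagram \<times> diagram) set" where
  "Sph2 n = diagrams n \<times> diagrams n"

definition generated_subgroup :: "diagram \<Rightarrow> diagram \<Rightarrow> (real \<Rightarrow> real) monoid" where
  "generated_subgroup D1 D2 =
     thompson_V \<lparr>carrier := generate thompson_V {diagram_map D1, diagram_map D2}\<rparr>"

definition free_pairs :: "(diagram \<times> diagram) set" where
  "free_pairs = {(D1, D2). D1 \<in> (\<Union>n. diagrams n) \<and> D2 \<in> (\<Union>n. diagrams n) \<and>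
     generated_subgroup D1 D2 \<cong> free_group {0 :: nat, 1}}"

end

theory Submission
  imports Defs "HOL-Computational_Algebra.Formal_Power_Series" "HOL-Real_Asymp.Real_Asymp"
begin

text \<open>The limit is \<open>1\<close>.  A large uniformly random binary tree has, for every fixed depth \<open>d\<close>, all but
  a bounded number of its leaves below a single node of depth \<open>d\<close>, and each of the \<open>2 ^ d\<close> nodes
  is equally likely to be this one.  A random bijection of the leaves sends the few leaves of the
  source tree that are not below its heavy node to leaves below the heavy node of the target tree.
  So a random diagram maps the complement of a dyadic interval of length \<open>1 / 2 ^ d\<close> into another
  such interval, with probability close to \<open>1\<close>.  The four intervals of a random pair of diagrams
  are distinct, hence disjoint, with probability tending to \<open>1\<close> as \<open>d\<close> grows, and then the two
  elements play ping-pong.\<close>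

section \<open>Counting trees\<close>

text \<open>Boundedness comes from criticality: at its radius of convergence 1/4 the generating
  function of the Catalan numbers converges, and \<open>catalan k / 4 ^ Suc k\<close> sums to 1/2.
  This is the limiting probability that a given child of the root is the one of bounded size; the
  two halves exhaust the mass, so in the limit the two children are never both large. Each further
  level of an address halves the share again.

  Everything is counted from below only. The families found for different addresses are disjoint
  once the trees are large, their shares add up to nearly 1, and a proportion never exceeds 1. So
  the limit exists although the free pairs themselves are never counted.

  The order of choices matters: the depth \<open>d\<close>, then a share \<open>c\<close> slightly
  below \<open>1 / 2 ^ d\<close>, then a bound \<open>M\<close> for the number of exceptional
  leaves, and only then \<open>n\<close>. As \<open>M\<close> does not depend on \<open>n\<close>,
  the failure probability \<open>M\<^sup>2 / (n + 1)\<close> of a random permutation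
  vanishes.\<close>

definition trees :: "nat \<Rightarrow> unit tree set" where
  "trees n = {t. size t = n}"

definition catalan :: "nat \<Rightarrow> nat" where
  "catalan n = card (trees n)"

lemma trees_0: "trees 0 = {Leaf}"
  by (auto simp: trees_def)

lemma trees_Suc:
  "trees (Suc n) = (\<Union>k\<le>n. (\<lambda>(l, r). Node l () r) ` (trees k \<times> trees (n - k)))"
proof (intro equalityI subsetI)
  fix t assume "t \<in> trees (Suc n)"
  then obtain l r where "t = Node l () r" "size l + size r = n"
    by (cases t) (auto simp: trees_def)
  then show "t \<in> (\<Union>k\<le>n. (\<lambda>(l, r). Node l () r) ` (trees k \<times> trees (n - k)))"
    by (auto simp: trees_def image_iff intro!: bexI[of _ "size l"])
qed (auto simp: trees_def)

lemma finite_trees: "finite (trees n)"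
proof (induction n rule: less_induct)
  case (less n)
  then show ?case
    by (cases n) (auto simp: trees_0 trees_Suc)
qed

lemma catalan_0: "catalan 0 = 1"
  by (simp add: catalan_def trees_0)

lemma catalan_Suc: "catalan (Suc n) = (\<Sum>k\<le>n. catalan k * catalan (n - k))"
proof -
  have "catalan (Suc n) =
      (\<Sum>k\<le>n. card ((\<lambda>(l, r). Node l () r) ` (trees k \<times> trees (n - k))))"
    unfolding catalan_def trees_Suc
    by (rule card_UN_disjoint) (auto simp: finite_trees, auto simp: trees_def)
  also have "\<dots> = (\<Sum>k\<le>n. card (trees k \<times> trees (n - k)))"
    by (intro sum.cong refl card_image) (auto simp: inj_on_def)
  finally show ?thesis
    by (simp add: catalan_def card_cartesian_product)
qed

text \<open>The generating function \<open>C\<close> satisfies \<open>C = 1 + x C\<^sup>2\<close>, so \<open>y = 1 - 2 x C\<close> is a square root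
  of \<open>1 - 4 x\<close>; differentiating \<open>y\<^sup>2 = 1 - 4 x\<close> gives the linear equation \<open>(1 - 4 x) y' = - 2 y\<close>.\<close>

lemma catalan_ratio:
  "real (n + 2) * real (catalan (Suc n)) = real (4 * n + 2) * real (catalan n)"
proof -
  define F :: "real fps" where "F = Abs_fps (\<lambda>n. real (catalan n))"
  define y where "y = 1 - 2 * fps_X * F"
  have F: "F = 1 + fps_X * F ^ 2"
  proof (rule fps_ext)
    fix n
    have "fps_nth (F\<^sup>2) m = real (catalan (Suc m))" for m
      by (simp add: F_def catalan_Suc power2_eq_square fps_mult_nth atLeast0AtMost)
    then show "fps_nth F n = fps_nth (1 + fps_X * F\<^sup>2) n"
      by (cases n) (simp_all add: F_def catalan_0)
  qed
  have "y * y = 1 - 4 * fps_X * (F - fps_X * F ^ 2)"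
    by (simp add: y_def algebra_simps power2_eq_square)
  also have "F - fps_X * F ^ 2 = 1"
    using F by (metis add_diff_cancel_right')
  finally have yy: "y * y = 1 - 4 * fps_X" by simp
  have "fps_deriv (y * y) = fps_deriv (1 - 4 * fps_X)"
    using yy by simp
  then have "2 * (y * fps_deriv y) = 2 * (- 2)"
    by (simp add: algebra_simps)
  then have "y * fps_deriv y = - 2"
    by (simp only: mult_cancel_left) auto
  then have "(y * y) * fps_deriv y = - 2 * y"
    by (metis mult.assoc mult.commute)
  \<comment> \<open>Coefficient \<open>Suc n\<close> of the linear equation involves
    \<open>y\<close> at the indices \<open>n + 1\<close> and \<open>n + 2\<close>, where it is -2
    times \<open>catalan n\<close> and \<open>catalan (Suc n)\<close>.\<close>
  then have "fps_nth ((1 - 4 * fps_X) * fps_deriv y) (Suc n) = fps_nth (- 2 * y) (Suc n)"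
    by (simp add: yy)
  moreover have "fps_nth y (Suc m) = - 2 * real (catalan m)" for m
    by (simp add: y_def F_def mult.assoc fps_numeral_nth numeral_fps_const)
  ultimately show ?thesis
    by (simp add: algebra_simps numeral_fps_const)
qed

lemma catalan_pos: "catalan n > 0"
proof (induction n)
  case (Suc n)
  then show ?case
    using catalan_ratio[of n] by (cases "catalan (Suc n)") auto
qed (simp add: catalan_0)

lemma catalan_nonzero: "catalan n \<noteq> 0"
  using catalan_pos[of n] by simp

text \<open>The quotient is a product of \<open>k\<close> factors of the form (j + 2) / (4 j + 2),
  each tending to 1/4.\<close>

lemma catalan_quotient_tendsto:
  "(\<lambda>n. real (catalan n) / real (catalan (n + k))) \<longlonglongrightarrow> 1 / 4 ^ k"
proof (induction k)
  case 0
  then show ?case by (simp add: catalan_nonzero)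
next
  case (Suc k)
  have "real (catalan (n + k)) / real (catalan (n + Suc k))
      = real (n + k + 2) / real (4 * (n + k) + 2)" for n
    using catalan_ratio[of "n + k"] catalan_pos[of "Suc (n + k)"]
    by (simp add: field_simps)
  moreover have "(\<lambda>n. real (n + k + 2) / real (4 * (n + k) + 2)) \<longlonglongrightarrow> 1 / 4"
    by real_asymp
  ultimately have "(\<lambda>n. real (catalan (n + k)) / real (catalan (n + Suc k))) \<longlonglongrightarrow> 1 / 4"
    by presburger
  from tendsto_mult[OF Suc this] show ?case
    by (simp add: catalan_nonzero mult.commute)
qed

text \<open>The sum telescopes. The number \<open>(m + 1) * catalan m\<close> is the central
  binomial coefficient, so the remainder is half the probability that a simple random walk is at 0
  after \<open>2 * m\<close> steps.\<close>

lemma sum_catalan: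
  "(\<Sum>k<m. real (catalan k) / 4 ^ Suc k) = 1 / 2 - real (m + 1) * real (catalan m) / (2 * 4 ^ m)"
proof (induction m)
  case (Suc m)
  have C: "real (Suc m + 1) * real (catalan (Suc m)) = 2 * real (2 * m + 1) * real (catalan m)"
    using catalan_ratio[of m] by (simp add: algebra_simps)
  show ?case
    unfolding sum.lessThan_Suc Suc C by (simp add: field_simps)
qed (simp add: catalan_0)

text \<open>An elementary Wallis bound in place of Stirling's formula: the left side is
  nonincreasing in \<open>m\<close>, because the base of the square gains the factor (2m + 1) / (2m
  + 2) and (2m + 1)(2m + 3) is at most (2m + 2)^2.\<close>

lemma catalan_square_bound:
  "(real (m + 1) * real (catalan m) / 4 ^ m)\<^sup>2 * real (2 * m + 1) \<le> 1"
proof (induction m)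
  case (Suc m)
  define v where "v = real (m + 1) * real (catalan m) / 4 ^ m"
  have C: "real (Suc m + 1) * real (catalan (Suc m)) = 2 * real (2 * m + 1) * real (catalan m)"
    using catalan_ratio[of m] by (simp add: algebra_simps)
  have "real (Suc m + 1) * real (catalan (Suc m)) / 4 ^ Suc m
      = v * real (2 * m + 1) / real (2 * m + 2)"
  proof -
    have "2 * (2 * x + 1) * c / (4 * q) = (x + 1) * c / q * (2 * x + 1) / (2 * x + 2)"
      if "x \<ge> 0" "q > 0" for x c q :: real
      using that by (simp add: divide_simps) (simp add: algebra_simps)
    from this[of "real m" "4 ^ m" "real (catalan m)"] show ?thesis
      unfolding C v_def by (simp add: add_ac)
  qed
  moreover have "(v * a / b)\<^sup>2 * c = v\<^sup>2 * a * (a * c / b\<^sup>2)" for a b c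
    by (simp add: power2_eq_square)
  moreover have "2 * Suc m + 1 = 2 * m + 3" by simp
  ultimately have "(real (Suc m + 1) * real (catalan (Suc m)) / 4 ^ Suc m)\<^sup>2 * real (2 * Suc m + 1)
      = v\<^sup>2 * real (2 * m + 1) * (real ((2 * m + 1) * (2 * m + 3)) / real ((2 * m + 2)\<^sup>2))"
    by (simp only: of_nat_mult of_nat_power)
  also have "\<dots> \<le> v\<^sup>2 * real (2 * m + 1) * 1"
  proof (rule mult_left_mono)
    have "(2 * m + 1) * (2 * m + 3) \<le> (2 * m + 2)\<^sup>2"
      by (simp add: power2_eq_square algebra_simps)
    then show "real ((2 * m + 1) * (2 * m + 3)) / real ((2 * m + 2)\<^sup>2) \<le> 1"
      by (simp only: divide_le_eq_1 of_nat_le_iff of_nat_0_less_iff) simp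
  qed simp
  finally show ?case
    using Suc by (simp add: v_def)
qed (simp add: catalan_0)

lemma catalan_sums: "(\<lambda>k. real (catalan k) / 4 ^ Suc k) sums (1 / 2)"
proof -
  define v where "v m = real (m + 1) * real (catalan m) / 4 ^ m" for m
  have "(\<lambda>m. (v m)\<^sup>2) \<longlonglongrightarrow> 0"
  proof (rule tendsto_sandwich[of "\<lambda>_. 0" _ _ "\<lambda>m. 1 / real (2 * m + 1)"])
    have "(v m)\<^sup>2 \<le> 1 / real (2 * m + 1)" for m
      using catalan_square_bound[of m] by (simp add: v_def field_simps)
    then show "eventually (\<lambda>m. (v m)\<^sup>2 \<le> 1 / real (2 * m + 1)) sequentially" by simp
    show "(\<lambda>m. 1 / real (2 * m + 1)) \<longlonglongrightarrow> 0" by real_asymp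
  qed auto
  then have "v \<longlonglongrightarrow> 0"
    by (simp add: tendsto_null_power)
  then have "(\<lambda>m. 1 / 2 - v m / 2) \<longlonglongrightarrow> 1 / 2 - 0 / 2"
    by (intro tendsto_intros) auto
  then show ?thesis
    unfolding sums_def sum_catalan v_def by (simp add: field_simps)
qed

section \<open>Concentration of a random tree below one node of fixed depth\<close>

text \<open>An address lists the turns on the way down from the root, \<open>True\<close> meaning right.  If the node
  with address \<open>p\<close> exists in \<open>t\<close>, then \<open>outside p t\<close> counts the leaves of \<open>t\<close> that are not below it.\<close>

fun outside :: "bool list \<Rightarrow> 'a tree \<Rightarrow> nat" where
  "outside [] t = 0"
| "outside (b # p) Leaf = 1"
| "outside (b # p) (Node l x r) =
     (if b then size l + 1 + outside p r else outside p l + size r + 1)"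

text \<open>No leaf lies below two different nodes of the same depth, so each leaf is counted at
  least once on the right. If an address runs out of the tree, \<open>outside\<close> counts all the
  leaves, which keeps the bound valid.\<close>

lemma outside_add_outside:
  "length p = length q \<Longrightarrow> p \<noteq> q \<Longrightarrow> size t + 1 \<le> outside p t + outside q t"
proof (induction p arbitrary: q t)
  case (Cons b p)
  then obtain b' q' where "q = b' # q'" "length p = length q'"
    by (cases q) auto
  with Cons show ?case
  proof (cases t)
    case (Node l x r)
    then show ?thesis
      using Cons.IH[of q' l] Cons.IH[of q' r] Cons.prems \<open>q = _\<close> by auto
  qed simp
qed simp

definition concentrated :: "bool list \<Rightarrow> nat \<Rightarrow> nat \<Rightarrow> unit tree set" where
  "concentrated p M n = {t \<in> trees n. outside p t \<le> M}"

text \<open>Grafting a tree of size \<open>k < m\<close> beside the path adds \<open>k + 1\<close>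
  outside leaves, at most \<open>m\<close>. The size of the grafted tree can be read off the result,
  so the families for different \<open>k\<close> are disjoint.\<close>

lemma concentrated_Cons_card:
  assumes "m \<le> n"
  shows "(\<Sum>k<m. catalan k * card (concentrated p M (n - k)))
    \<le> card (concentrated (b # p) (M + m) (Suc n))"
proof -
  define graft where "graft = (\<lambda>(s, t). if b then Node s () t else Node t () s)"
  let ?A = "\<lambda>k. graft ` (trees k \<times> concentrated p M (n - k))"
  have fin: "finite (concentrated p M k)" for p M k
    by (simp add: concentrated_def finite_trees)
  have "(\<Sum>k<m. catalan k * card (concentrated p M (n - k))) = (\<Sum>k<m. card (?A k))"
    by (intro sum.cong refl, subst card_image)
      (auto simp: inj_on_def graft_def card_cartesian_product catalan_def split: if_splits)
  also have "\<dots> = card (\<Union>k<m. ?A k)"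
    by (rule card_UN_disjoint[symmetric])
      (auto simp: fin finite_trees, auto simp: graft_def trees_def split: if_splits)
  also have "\<dots> \<le> card (concentrated (b # p) (M + m) (Suc n))"
    using assms by (intro card_mono fin) (auto simp: concentrated_def trees_def graft_def)
  finally show ?thesis .
qed

text \<open>Lengthening the address by one turn multiplies the asymptotic share by a partial sum of
  the series with value 1/2. The strict hypothesis pays for cutting this series at some
  \<open>m\<close>, by which \<open>M\<close> then grows.\<close>

lemma concentrated_lower_bound:
  assumes "c < 1 / 2 ^ length p"
  shows "\<exists>M. \<forall>\<^sub>F n in sequentially. c * real (catalan n) \<le> real (card (concentrated p M n))"
  using assms
proof (induction p arbitrary: c)
  case Nil
  have "c * real (catalan n) \<le> real (card (concentrated [] 0 n))" for n
    using Nil by (simp add: concentrated_def catalan_def mult_left_le_one_le)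
      (metis catalan_def less_eq_real_def mult_1 mult_right_mono of_nat_0_le_iff)
  then show ?case by (intro exI[of _ 0]) simp
next
  case (Cons b p)
  \<comment> \<open>A share \<open>c'\<close> above \<open>2 * c\<close> for the tail
    \<open>p\<close> still leaves more than \<open>c\<close> after the halving.\<close>
  then have "max 0 (2 * c) < 1 / 2 ^ length p"
    by simp
  then obtain c' where c': "max 0 (2 * c) < c'" "c' < 1 / 2 ^ length p"
    using dense by blast
  have "(\<lambda>m. c' * (\<Sum>k<m. real (catalan k) / 4 ^ Suc k)) \<longlonglongrightarrow> c' * (1 / 2)"
    using catalan_sums unfolding sums_def by (intro tendsto_intros)
  then have "\<forall>\<^sub>F m in sequentially. c < c' * (\<Sum>k<m. real (catalan k) / 4 ^ Suc k)"
    using c' by (intro order_tendstoD) auto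
  then obtain m where m: "c < c' * (\<Sum>k<m. real (catalan k) / 4 ^ Suc k)"
    using eventually_happens by fastforce
  obtain M where M: "\<forall>\<^sub>F n in sequentially. c' * real (catalan n) \<le> real (card (concentrated p M n))"
    using Cons.IH[OF c'(2)] by blast
  \<comment> \<open>For \<open>k \<le> n\<close>, this quotient times \<open>catalan k\<close> is
    the proportion of trees of size \<open>Suc n\<close> whose child off the path has size
    \<open>k\<close>.\<close>
  have "(\<lambda>n. real (catalan (n - k)) / real (catalan (Suc n))) \<longlonglongrightarrow> 1 / 4 ^ Suc k" for k
  proof (rule LIMSEQ_offset[where k = k])
    show "(\<lambda>n. real (catalan (n + k - k)) / real (catalan (Suc (n + k)))) \<longlonglongrightarrow> 1 / 4 ^ Suc k"
      using catalan_quotient_tendsto[of "Suc k"] by simp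
  qed
  then have "(\<lambda>n. c' * (\<Sum>k<m. real (catalan k) * (real (catalan (n - k)) / real (catalan (Suc n)))))
      \<longlonglongrightarrow> c' * (\<Sum>k<m. real (catalan k) * (1 / 4 ^ Suc k))"
    by (intro tendsto_mult[OF tendsto_const] tendsto_sum)
  then have 1: "\<forall>\<^sub>F n in sequentially.
      c < c' * (\<Sum>k<m. real (catalan k) * (real (catalan (n - k)) / real (catalan (Suc n))))"
    using m by (intro order_tendstoD(1)) auto
  have "\<forall>\<^sub>F n in sequentially. c' * real (catalan (n - k)) \<le> real (card (concentrated p M (n - k)))" for k
    using M by (subst eventually_sequentially_seg[of _ k, symmetric]) simp
  then have 2: "\<forall>\<^sub>F n in sequentially. \<forall>k\<in>{..<m}.
      c' * real (catalan (n - k)) \<le> real (card (concentrated p M (n - k)))"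
    by (intro eventually_ball_finite) auto
  have "\<forall>\<^sub>F n in sequentially. c * real (catalan (Suc n)) \<le> real (card (concentrated (b # p) (M + m) (Suc n)))"
    using 1 2 eventually_ge_at_top[of m]
  proof eventually_elim
    case (elim n)
    have "c * real (catalan (Suc n)) \<le>
        c' * (\<Sum>k<m. real (catalan k) * (real (catalan (n - k)) / real (catalan (Suc n))))
          * real (catalan (Suc n))"
      using elim(1) by (intro mult_right_mono) auto
    also have "\<dots> = (\<Sum>k<m. real (catalan k) * (c' * real (catalan (n - k))))"
      using catalan_pos[of "Suc n"] by (simp add: sum_distrib_left sum_distrib_right mult_ac)
    also have "\<dots> \<le> (\<Sum>k<m. real (catalan k) * real (card (concentrated p M (n - k))))"
      using elim(2) by (intro sum_mono mult_left_mono) auto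
    also have "\<dots> = real (\<Sum>k<m. catalan k * card (concentrated p M (n - k)))"
      by simp
    also have "\<dots> \<le> real (card (concentrated (b # p) (M + m) (Suc n)))"
      using concentrated_Cons_card[OF elim(3)] by (simp only: of_nat_le_iff)
    finally show ?case .
  qed
  then show ?case
    by (subst (asm) eventually_sequentially_Suc) blast
qed

section \<open>Leaf intervals and the elements of \<open>V\<close>\<close>

definition between :: "real \<times> real \<Rightarrow> real set" where
  "between I = {fst I..<snd I}"

lemma nth_leaf_intervals_Node:
  "leaf_intervals a b (Node l x r) ! i =
    (if i \<le> size l then leaf_intervals a ((a + b) / 2) l ! i
     else leaf_intervals ((a + b) / 2) b r ! (i - Suc (size l)))"
  by (simp add: nth_append length_leaf_intervals)

lemma leaf_intervals_subset:
  "a < b \<Longrightarrow> i \<le> size t \<Longrightarrow> between (leaf_intervals a b t ! i) \<subseteq> {a..<b}"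
proof (induction a b t arbitrary: i rule: leaf_intervals.induct)
  case (2 a b l u r)
  have m: "(a + b) / 2 < b" "a < (a + b) / 2" using 2 by auto
  show ?case
  proof (cases "i \<le> size l")
    case True
    have "between (leaf_intervals a ((a + b) / 2) l ! i) \<subseteq> {a..<(a + b) / 2}"
      by (rule 2(1)[OF m(2) True])
    also have "\<dots> \<subseteq> {a..<b}" using m by auto
    finally show ?thesis unfolding nth_leaf_intervals_Node using True by simp
  next
    case False
    have "between (leaf_intervals ((a + b) / 2) b r ! (i - Suc (size l))) \<subseteq> {(a + b) / 2..<b}"
      using 2(4) False by (intro 2(2)[OF m(1)]) simp
    also have "\<dots> \<subseteq> {a..<b}" using m by auto
    finally show ?thesis unfolding nth_leaf_intervals_Node using False by simp
  qed
qed (simp add: between_def)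

lemma leaf_intervals_unique:
  assumes "a < b" "x \<in> {a..<b}"
  shows "\<exists>!i. i \<le> size t \<and> x \<in> between (leaf_intervals a b t ! i)"
  using assms
proof (induction a b t rule: leaf_intervals.induct)
  case (2 a b l u r)
  define m where "m = (a + b) / 2"
  have m: "m < b" "a < m" using 2 by (auto simp: m_def)
  let ?P = "\<lambda>j. j \<le> size (Node l u r) \<and> x \<in> between (leaf_intervals a b (Node l u r) ! j)"
  show ?case
  proof (cases "x < m")
    case True
    have P: "?P j \<longleftrightarrow> j \<le> size l \<and> x \<in> between (leaf_intervals a m l ! j)" for j
    proof (cases "j \<le> size (Node l u r) \<and> size l < j")
      case j: True
      then have "j - Suc (size l) \<le> size r" by auto
      then show ?thesis
        using leaf_intervals_subset[OF m(1), of "j - Suc (size l)" r] True j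
        unfolding nth_leaf_intervals_Node m_def[symmetric] by auto
    qed (auto simp: nth_leaf_intervals_Node m_def simp del: leaf_intervals.simps)
    show ?thesis
      unfolding P using 2(1)[folded m_def] 2(3,4) m True by simp
  next
    case False
    have P: "?P j \<longleftrightarrow> size l < j \<and> j - Suc (size l) \<le> size r \<and>
        x \<in> between (leaf_intervals m b r ! (j - Suc (size l)))" for j
      using leaf_intervals_subset[OF m(2), of j l] False
      unfolding nth_leaf_intervals_Node m_def[symmetric] by (auto simp: subset_iff)
    have "\<exists>!i. i \<le> size r \<and> x \<in> between (leaf_intervals m b r ! i)"
      using 2(2)[folded m_def] 2(3,4) m False by simp
    then obtain i where i: "i \<le> size r" "x \<in> between (leaf_intervals m b r ! i)"
      and u: "\<And>j. j \<le> size r \<Longrightarrow> x \<in> between (leaf_intervals m b r ! j) \<Longrightarrow> j = i"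
      by auto
    show ?thesis
      unfolding P
    proof (rule ex1I[of _ "i + Suc (size l)"])
      fix k assume k: "size l < k \<and> k - Suc (size l) \<le> size r \<and>
        x \<in> between (leaf_intervals m b r ! (k - Suc (size l)))"
      then have "k - Suc (size l) = i" using u by blast
      then show "k = i + Suc (size l)" using k by auto
    qed (use i in simp)
  qed
qed (auto simp: between_def)

section \<open>Dyadic endpoints of leaf intervals\<close>

lemma dyadic_of_int: "of_int m \<in> dyadic"
  unfolding dyadic_def by (rule CollectI, rule exI[of _ m], rule exI[of _ 0]) simp

lemma dyadic_inverse_power: "1 / 2 ^ k \<in> dyadic"
  unfolding dyadic_def by (rule CollectI, rule exI[of _ 1], rule exI[of _ k]) simp

lemma dyadic_mult: "x \<in> dyadic \<Longrightarrow> y \<in> dyadic \<Longrightarrow> x * y \<in> dyadic"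
proof -
  assume "x \<in> dyadic" "y \<in> dyadic"
  then obtain m k m' k' where "x = of_int m / 2 ^ k" "y = of_int m' / 2 ^ k'"
    by (auto simp: dyadic_def)
  then have "x * y = of_int (m * m') / 2 ^ (k + k')" by (simp add: power_add)
  then show ?thesis unfolding dyadic_def by blast
qed

lemma dyadic_add: "x \<in> dyadic \<Longrightarrow> y \<in> dyadic \<Longrightarrow> x + y \<in> dyadic"
proof -
  assume "x \<in> dyadic" "y \<in> dyadic"
  then obtain m k m' k' where "x = of_int m / 2 ^ k" "y = of_int m' / 2 ^ k'"
    by (auto simp: dyadic_def)
  then have "x + y = of_int (m * 2 ^ k' + m' * 2 ^ k) / 2 ^ (k + k')"
    by (simp add: power_add add_divide_distrib)
  then show ?thesis unfolding dyadic_def by blast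
qed

lemma dyadic_diff: "x \<in> dyadic \<Longrightarrow> y \<in> dyadic \<Longrightarrow> x - y \<in> dyadic"
  using dyadic_add[OF _ dyadic_mult[OF dyadic_of_int[of "- 1"]], of x y] by simp

text \<open>Left end and length, rather than both ends, form the invariant that halving preserves;
  the lengths later make the slopes powers of 2.\<close>

lemma leaf_intervals_dyadic:
  assumes "a \<in> dyadic" "b - a = 1 / 2 ^ j" "(c, d) \<in> set (leaf_intervals a b t)"
  shows "c \<in> dyadic \<and> (\<exists>k. d - c = 1 / 2 ^ k)"
  using assms
proof (induction a b t arbitrary: j rule: leaf_intervals.induct)
  case (2 a b l u r)
  have b: "b = a + 1 / 2 ^ j" using 2 by simp
  have m: "(a + b) / 2 = a + 1 / 2 ^ Suc j" using 2 by (simp add: field_simps)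
  have "(a + b) / 2 \<in> dyadic"
    unfolding m using dyadic_add[OF 2(3) dyadic_inverse_power] .
  then show ?case
    using 2 2(1)[of "Suc j"] 2(2)[of "Suc j"] unfolding m by (auto simp: field_simps b)
qed auto

abbreviation lower :: "unit tree \<Rightarrow> nat \<Rightarrow> real" where
  "lower t i \<equiv> fst (leaf_interval t i)"

abbreviation upper :: "unit tree \<Rightarrow> nat \<Rightarrow> real" where
  "upper t i \<equiv> snd (leaf_interval t i)"

lemma leaf_interval_length: "i \<le> size t \<Longrightarrow> \<exists>k. upper t i - lower t i = 1 / 2 ^ k"
  and lower_dyadic: "i \<le> size t \<Longrightarrow> lower t i \<in> dyadic"
proof -
  assume "i \<le> size t"
  then have "(lower t i, upper t i) \<in> set (leaf_intervals 0 1 t)"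
    unfolding leaf_interval_def by (simp add: length_leaf_intervals)
  then have "lower t i \<in> dyadic \<and> (\<exists>k. upper t i - lower t i = 1 / 2 ^ k)"
    using dyadic_of_int[of 0] by (intro leaf_intervals_dyadic[of 0 1 0]) auto
  then show "\<exists>k. upper t i - lower t i = 1 / 2 ^ k" "lower t i \<in> dyadic" by auto
qed

lemma upper_dyadic: "i \<le> size t \<Longrightarrow> upper t i \<in> dyadic"
  using leaf_interval_length[of i t] dyadic_add[OF lower_dyadic[of i t] dyadic_inverse_power]
  by (metis add_diff_cancel_left' add_diff_eq)

lemma lower_less_upper: "i \<le> size t \<Longrightarrow> lower t i < upper t i"
  using leaf_interval_length[of i t] by (smt (verit) zero_less_divide_1_iff zero_less_power)

lemma leaf_interval_subset: "i \<le> size t \<Longrightarrow> between (leaf_interval t i) \<subseteq> {0..<1}"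
  unfolding leaf_interval_def by (rule leaf_intervals_subset) auto

lemma leaf_interval_ex1: "x \<in> {0..<1} \<Longrightarrow> \<exists>!i. i \<le> size t \<and> x \<in> between (leaf_interval t i)"
  unfolding leaf_interval_def by (rule leaf_intervals_unique) auto

section \<open>Diagrams as elements of \<open>V\<close>\<close>

definition stretch :: "real \<times> real \<Rightarrow> real \<times> real \<Rightarrow> real \<Rightarrow> real" where
  "stretch I J x = fst J + (x - fst I) * ((snd J - fst J) / (snd I - fst I))"

lemma stretch_between:
  assumes "fst J < snd J" "x \<in> between I"
  shows "stretch I J x \<in> between J"
proof -
  define s where "s = (x - fst I) / (snd I - fst I)"
  have "0 \<le> s" "s < 1" using assms by (auto simp: s_def between_def)
  then have "0 \<le> s * (snd J - fst J)" "s * (snd J - fst J) < 1 * (snd J - fst J)"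
    using assms(1) by (simp, intro mult_strict_right_mono) auto
  moreover have "stretch I J x = fst J + s * (snd J - fst J)"
    by (simp add: stretch_def s_def)
  ultimately show ?thesis by (simp add: between_def)
qed

lemma stretch_stretch:
  "fst I < snd I \<Longrightarrow> fst J < snd J \<Longrightarrow> stretch J I (stretch I J x) = x"
  by (simp add: stretch_def)

text \<open>Only one leaf interval contains \<open>x\<close>, so the definite description in
  \<open>diagram_map\<close> has exactly one candidate.\<close>

lemma diagram_map_eq:
  assumes "i \<le> size S" "x \<in> between (leaf_interval S i)"
  shows "diagram_map (S, R, p) x = stretch (leaf_interval S i) (leaf_interval R (p i)) x"
proof -
  have x: "x \<in> {0..<1}" using assms leaf_interval_subset by blast
  have u: "j \<le> size S \<and> x \<in> between (leaf_interval S j) \<longleftrightarrow> j = i" for j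
    using leaf_interval_ex1[OF x, of S] assms by auto
  have "(\<exists>j\<le>size S. let (a, b) = leaf_interval S j; (c, d) = leaf_interval R (p j)
     in x \<in> {a..<b} \<and> y = c + (x - a) * ((d - c) / (b - a))) \<longleftrightarrow>
     (\<exists>j. (j \<le> size S \<and> x \<in> between (leaf_interval S j)) \<and>
       y = stretch (leaf_interval S j) (leaf_interval R (p j)) x)" for y
    by (simp add: between_def stretch_def case_prod_beta Let_def conj_assoc)
  then show ?thesis
    using x unfolding diagram_map_def u by simp
qed

text \<open>Exchanging the two trees and inverting the permutation reverses each affine
  piece.\<close>

lemma diagram_map_inverse:
  assumes "(S, R, p) \<in> diagrams n" "x \<in> {0..<1}"
  shows "diagram_map (S, R, p) x \<in> {0..<1}"
    "diagram_map (R, S, inv_into UNIV p) (diagram_map (S, R, p) x) = x"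
proof -
  have size: "size S = n" "size R = n" and p: "p permutes {0..n}"
    using assms by (auto simp: diagrams_def)
  obtain i where i: "i \<le> n" "x \<in> between (leaf_interval S i)"
    using leaf_interval_ex1[OF assms(2), of S] size by auto
  then have pi: "p i \<le> n" using permutes_in_image[OF p, of i] by simp
  let ?y = "diagram_map (S, R, p) x"
  have y: "?y = stretch (leaf_interval S i) (leaf_interval R (p i)) x"
    using i size by (intro diagram_map_eq) auto
  then have y': "?y \<in> between (leaf_interval R (p i))"
    using stretch_between[OF lower_less_upper i(2)] pi size by simp
  then show "?y \<in> {0..<1}"
    using leaf_interval_subset[of "p i" R] pi size by auto
  show "diagram_map (R, S, inv_into UNIV p) ?y = x"
    using diagram_map_eq[OF _ y', of S "inv_into UNIV p"] pi size i permutes_inverses(2)[OF p]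
    by (simp add: y stretch_stretch lower_less_upper)
qed

lemma diagrams_inverse: "(S, R, p) \<in> diagrams n \<Longrightarrow> (R, S, inv_into UNIV p) \<in> diagrams n"
  by (auto simp: diagrams_def permutes_inv)

lemma diagram_map_Bij:
  assumes "D \<in> diagrams n"
  shows "diagram_map D \<in> Bij {0..<1}"
proof -
  obtain S R p where D: "D = (S, R, p)" by (cases D)
  have "inv_into UNIV (inv_into UNIV p) = p"
    using assms permutes_bij inv_inv_eq unfolding diagrams_def D by blast
  then have "bij_betw (diagram_map D) {0..<1} {0..<1}"
    using diagram_map_inverse[of S R p n] diagram_map_inverse[of R S "inv_into UNIV p" n]
      diagrams_inverse[of S R p n] assms unfolding D
    by (intro bij_betw_byWitness[where f' = "diagram_map (R, S, inv_into UNIV p)"]) auto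
  moreover have "diagram_map D \<in> extensional {0..<1}"
    by (simp add: diagram_map_def D)
  ultimately show ?thesis
    by (simp add: Bij_def)
qed

lemma diagram_map_thompson_V:
  assumes D: "D \<in> diagrams n"
  shows "diagram_map D \<in> thompson_V_set"
proof -
  obtain S R p where D': "D = (S, R, p)" by (cases D)
  have size: "size S = n" "size R = n" and p: "p permutes {0..n}"
    using D by (auto simp: diagrams_def D')
  let ?I = "leaf_interval S" and ?J = "\<lambda>i. leaf_interval R (p i)"
  have leaf: "\<exists>i\<le>n. p i \<le> n \<and> x \<in> between (?I i)" if "x \<in> {0..<1}" for x
    using leaf_interval_ex1[OF that, of S] permutes_in_image[OF p] size by fastforce
  have eq: "diagram_map D x = stretch (?I i) (?J i) x" if "i \<le> n" "x \<in> between (?I i)" for i x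
    using that size unfolding D' by (intro diagram_map_eq) auto
  have ratio: "\<exists>j k. upper R (p i) - lower R (p i) = 1 / 2 ^ j \<and> upper S i - lower S i = 1 / 2 ^ k"
    if "i \<le> n" "p i \<le> n" for i
    using that size leaf_interval_length[of i S] leaf_interval_length[of "p i" R] by auto
  have "continuous (at_right a) (\<lambda>x. cis (2 * pi * diagram_map D x))" if "a \<in> {0..<1}" for a
  proof -
    obtain i where i: "i \<le> n" "a \<in> between (?I i)" using leaf[OF \<open>a \<in> {0..<1}\<close>] by auto
    \<comment> \<open>Leaf intervals are half-open, so points slightly to the right of
      \<open>a\<close> stay in the leaf of \<open>a\<close>; there the map agrees with an affine map
      of the whole line.\<close>
    have "\<forall>\<^sub>F x in at_right a. x \<in> between (?I i)"
      using i(2) eventually_at_right_real[of a "upper S i"]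
      by (auto simp: between_def elim!: eventually_mono)
    then have ev: "\<forall>\<^sub>F x in at_right a.
        cis (2 * pi * stretch (?I i) (?J i) x) = cis (2 * pi * diagram_map D x)"
      by eventually_elim (simp add: eq[OF i(1)])
    have "isCont (\<lambda>x. cis (2 * pi * stretch (?I i) (?J i) x)) a"
      unfolding stretch_def divide_inverse cis_conv_exp by (intro continuous_intros)
    then have "((\<lambda>x. cis (2 * pi * stretch (?I i) (?J i) x)) \<longlongrightarrow>
        cis (2 * pi * stretch (?I i) (?J i) a)) (at_right a)"
      by (simp add: isCont_def filterlim_at_split)
    then show ?thesis
      unfolding continuous_within eq[OF i] by (rule Lim_transform_eventually[OF _ ev])
  qed
  moreover have "diagram_map D x \<in> dyadic" if "x \<in> dyadic \<inter> {0..<1}" for x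
  proof -
    obtain i where i: "i \<le> n" "p i \<le> n" "x \<in> between (?I i)" using leaf[of x] \<open>x \<in> _\<close> by auto
    obtain j k where jk: "upper R (p i) - lower R (p i) = 1 / 2 ^ j"
      "upper S i - lower S i = 1 / 2 ^ k" using ratio[OF i(1,2)] by auto
    have "diagram_map D x = lower R (p i) + (x - lower S i) * (of_int (2 ^ k) * (1 / 2 ^ j))"
      using eq[OF i(1,3)] by (simp add: stretch_def jk)
    moreover have "lower R (p i) \<in> dyadic" "lower S i \<in> dyadic"
      using i size lower_dyadic by auto
    ultimately show ?thesis
      using that dyadic_add dyadic_diff dyadic_mult dyadic_of_int dyadic_inverse_power
      by (metis IntD1)
  qed
  moreover have "\<exists>B. finite B \<and> B \<subseteq> dyadic \<and>
       (\<forall>a b. {a<..<b} \<subseteq> {0..<1} - B \<longrightarrow>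
         (\<exists>(k :: int) c. \<forall>x\<in>{a<..<b}. diagram_map D x = frac (2 powi k * x + c)))"
  proof (intro exI[of _ "lower S ` {..n} \<union> upper S ` {..n}"] conjI allI impI)
    show "lower S ` {..n} \<union> upper S ` {..n} \<subseteq> dyadic"
      using size lower_dyadic upper_dyadic by auto
    fix a b :: real
    assume ab: "{a<..<b} \<subseteq> {0..<1} - (lower S ` {..n} \<union> upper S ` {..n})"
    show "\<exists>(k :: int) c. \<forall>x\<in>{a<..<b}. diagram_map D x = frac (2 powi k * x + c)"
    proof (cases "a < b")
      case True
      \<comment> \<open>The leaf containing the midpoint contains the whole open interval, since no
        endpoint of a leaf separates its points.\<close>
      have m: "(a + b) / 2 \<in> {a<..<b}" using True by simp
      then obtain i where i: "i \<le> n" "p i \<le> n" "(a + b) / 2 \<in> between (?I i)"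
        using leaf[of "(a + b) / 2"] ab by blast
      have "lower S i \<notin> {a<..<b}" "upper S i \<notin> {a<..<b}" using ab i(1) by blast+
      then have "lower S i \<le> a" "b \<le> upper S i"
        using i(3) m by (auto simp: between_def)
      then have sub: "x \<in> between (?I i)" if "x \<in> {a<..<b}" for x
        using that by (auto simp: between_def)
      obtain j k where jk: "upper R (p i) - lower R (p i) = 1 / 2 ^ j"
        "upper S i - lower S i = 1 / 2 ^ k" using ratio[OF i(1,2)] by auto
      have q: "2 powi (int k - int j) = (2::real) ^ k / 2 ^ j"
        by (simp add: power_int_diff)
      have "diagram_map D x = frac (2 powi (int k - int j) * x +
          (lower R (p i) - lower S i * 2 powi (int k - int j)))" if "x \<in> {a<..<b}" for x
      proof -
        \<comment> \<open>The value already lies in \<open>{0..<1}\<close>, so \<open>frac\<close>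
          does not change it.\<close>
        have "diagram_map D x \<in> {0..<1}"
          using diagram_map_inverse(1)[of S R p n x] that ab D unfolding D' by blast
        moreover have "diagram_map D x = 2 powi (int k - int j) * x +
          (lower R (p i) - lower S i * 2 powi (int k - int j))"
          using eq[OF i(1) sub[OF that]] by (simp add: stretch_def jk q algebra_simps diff_divide_distrib)
        ultimately show ?thesis by (simp add: frac_eq)
      qed
      then show ?thesis by blast
    qed auto
  qed auto
  ultimately show ?thesis
    unfolding thompson_V_set_def using diagram_map_Bij[OF D] by blast
qed

text \<open>For \<open>a = 0\<close> and \<open>b = 1\<close> these are the numbers whose binary
  expansion begins with the digits \<open>p\<close>, with \<open>True\<close> as the digit
  1.\<close>

fun address_interval :: "real \<Rightarrow> real \<Rightarrow> bool list \<Rightarrow> real set" where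
  "address_interval a b [] = {a..<b}"
| "address_interval a b (x # p) =
     (if x then address_interval ((a + b) / 2) b p else address_interval a ((a + b) / 2) p)"

lemma address_interval_subset: "a < b \<Longrightarrow> address_interval a b p \<subseteq> {a..<b}"
proof (induction p arbitrary: a b)
  case (Cons x p)
  have m: "(a + b) / 2 < b" "a < (a + b) / 2" using Cons by auto
  then show ?case
    using Cons.IH[OF m(1)] Cons.IH[OF m(2)] by (auto simp: subset_iff)
qed simp

lemma address_interval_nonempty: "a < b \<Longrightarrow> address_interval a b p \<noteq> {}"
  by (induction p arbitrary: a b) auto

lemma address_interval_disjoint:
  "a < b \<Longrightarrow> length p = length q \<Longrightarrow> p \<noteq> q \<Longrightarrow> address_interval a b p \<inter> address_interval a b q = {}"
proof (induction p arbitrary: q a b)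
  case (Cons x p)
  then obtain y q' where q: "q = y # q'" "length p = length q'"
    by (cases q) auto
  have m: "a < (a + b) / 2" "(a + b) / 2 < b" using Cons by auto
  have "address_interval a ((a + b) / 2) r \<inter> address_interval ((a + b) / 2) b s = {}" for r s
    using address_interval_subset[OF m(1), of r] address_interval_subset[OF m(2), of s] by fastforce
  then show ?case
    using Cons.IH[OF m(1), of q'] Cons.IH[OF m(2), of q'] Cons.prems q
    by (cases x; cases y) (simp_all add: Int_commute)
qed simp

section \<open>Ping-pong\<close>

definition letter_value :: "('g, 'm) monoid_scheme \<Rightarrow> ('a \<Rightarrow> 'g) \<Rightarrow> 'a \<times> bool \<Rightarrow> 'g" where
  "letter_value G g x = (if snd x then g (fst x) else inv\<^bsub>G\<^esub> g (fst x))"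

definition word_value :: "('g, 'm) monoid_scheme \<Rightarrow> ('a \<Rightarrow> 'g) \<Rightarrow> ('a \<times> bool) list \<Rightarrow> 'g" where
  "word_value G g w = foldr (\<lambda>x y. letter_value G g x \<otimes>\<^bsub>G\<^esub> y) w \<one>\<^bsub>G\<^esub>"

lemma word_value_simps [simp]:
  "word_value G g [] = \<one>\<^bsub>G\<^esub>"
  "word_value G g (x # w) = letter_value G g x \<otimes>\<^bsub>G\<^esub> word_value G g w"
  by (simp_all add: word_value_def)

context group
begin

lemma letter_value_closed:
  "g ` A \<subseteq> carrier G \<Longrightarrow> fst x \<in> A \<Longrightarrow> letter_value G g x \<in> carrier G"
  by (auto simp: letter_value_def)

lemma letter_value_inv:
  "g ` A \<subseteq> carrier G \<Longrightarrow> fst x \<in> A \<Longrightarrow> letter_value G g (inv_letter x) = inv letter_value G g x"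
  by (auto simp: letter_value_def inv_letter_def)

lemma word_value_closed:
  "g ` A \<subseteq> carrier G \<Longrightarrow> fst ` set w \<subseteq> A \<Longrightarrow> word_value G g w \<in> carrier G"
  by (induction w) (auto simp: letter_value_closed)

text \<open>The case with content is cancellation: the first letter of \<open>w\<close> then
  evaluates to the inverse of the value of \<open>x\<close>, and dropping both changes
  nothing.\<close>

lemma word_value_push:
  assumes "g ` A \<subseteq> carrier G" "fst x \<in> A" "fst ` set w \<subseteq> A"
  shows "word_value G g (push_letter x w) = letter_value G g x \<otimes> word_value G g w"
proof (cases w)
  case (Cons y v)
  have "word_value G g v = letter_value G g x \<otimes> (inv letter_value G g x \<otimes> word_value G g v)"
    using assms Cons letter_value_closed[OF assms(1,2)] word_value_closed[OF assms(1), of v]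
    by (simp add: m_assoc[symmetric])
  then show ?thesis
    using Cons letter_value_inv[OF assms(1,2)] by simp
qed simp

lemma word_value_foldr_push:
  assumes "g ` A \<subseteq> carrier G" "fst ` set u \<subseteq> A" "fst ` set v \<subseteq> A"
  shows "word_value G g (foldr push_letter u v) = word_value G g u \<otimes> word_value G g v"
  using assms(2)
proof (induction u)
  case Nil
  then show ?case using word_value_closed[OF assms(1,3)] by simp
next
  case (Cons x u)
  have "fst ` set (foldr push_letter u v) \<subseteq> A"
    using image_mono[OF set_foldr_push[of u v], of fst] Cons.prems assms(3)
    by (simp add: image_Un) blast
  then show ?case
    using Cons word_value_push[OF assms(1), of x] assms(3)
      letter_value_closed[OF assms(1), of x] word_value_closed[OF assms(1), of u]
      word_value_closed[OF assms(1), of v]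
    by (simp add: m_assoc)
qed

lemma word_value_hom:
  assumes "g ` A \<subseteq> carrier G"
  shows "group_hom (free_group A) G (word_value G g)"
proof -
  have "word_value G g \<in> hom (free_group A) G"
    unfolding hom_def free_group_def reduced_words_def
    using word_value_closed[OF assms] word_value_foldr_push[OF assms] by auto
  then show ?thesis
    using group_free_group[of A] by (simp add: group_hom_def group_hom_axioms_def)
qed

lemma word_value_image:
  assumes "g ` A \<subseteq> carrier G"
  shows "word_value G g ` carrier (free_group A) = generate G (g ` A)"
proof (intro equalityI subsetI)
  have gen: "subgroup (generate G (g ` A)) G"
    using assms by (rule generate_is_subgroup)
  fix z assume "z \<in> word_value G g ` carrier (free_group A)"
  then obtain w where w: "z = word_value G g w" "fst ` set w \<subseteq> A"
    by (auto simp: free_group_def reduced_words_def)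
  have "word_value G g w \<in> generate G (g ` A)"
    using w(2)
  proof (induction w)
    case (Cons x w)
    then have "letter_value G g x \<in> generate G (g ` A)"
      by (auto simp: letter_value_def generate.incl generate.inv)
    with Cons show ?case by (simp add: generate.eng)
  qed (simp add: generate.one)
  with w show "z \<in> generate G (g ` A)" by simp
next
  interpret h: group_hom "free_group A" G "word_value G g"
    using assms by (rule word_value_hom)
  fix z assume "z \<in> generate G (g ` A)"
  then show "z \<in> word_value G g ` carrier (free_group A)"
  proof induction
    case one
    then show ?case by (rule image_eqI[of _ _ "[]"]) (simp_all add: free_group_def reduced_words_def reduced_def)
  next
    case (incl z)
    then obtain i where "i \<in> A" "z = g i" by blast
    then have "z = word_value G g [(i, True)]" "[(i, True)] \<in> carrier (free_group A)"
      using assms by (auto simp: letter_value_def free_group_def reduced_words_def reduced_def)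
    then show ?case by blast
  next
    case (inv z)
    then obtain i where "i \<in> A" "z = g i" by blast
    then have "inv z = word_value G g [(i, False)]" "[(i, False)] \<in> carrier (free_group A)"
      using assms by (auto simp: letter_value_def free_group_def reduced_words_def reduced_def)
    then show ?case by blast
  next
    case (eng y z)
    then obtain u v where "u \<in> carrier (free_group A)" "v \<in> carrier (free_group A)"
      "y = word_value G g u" "z = word_value G g v"
      by blast
    then show ?case
      using h.hom_mult[of u v] h.m_closed[of u v] by (metis imageI)
  qed
qed

text \<open>Evaluation of words is a homomorphism onto the generated subgroup, and the second
  hypothesis says that its kernel is trivial.\<close>

lemma generate_iso_free_group:
  assumes g: "g ` A \<subseteq> carrier G"
    and nontrivial: "\<And>w. w \<in> reduced_words A \<Longrightarrow> w \<noteq> [] \<Longrightarrow> word_value G g w \<noteq> \<one>"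
  shows "G\<lparr>carrier := generate G (g ` A)\<rparr> \<cong> free_group A"
proof -
  interpret h: group_hom "free_group A" G "word_value G g"
    using g by (rule word_value_hom)
  have "inj_on (word_value G g) (carrier (free_group A))"
    unfolding h.inj_on_one_iff using nontrivial by (auto simp: free_group_def)
  then have "word_value G g \<in> iso (free_group A) (G\<lparr>carrier := generate G (g ` A)\<rparr>)"
    using h.homh word_value_image[OF g] unfolding iso_def hom_def bij_betw_def by auto
  then have "free_group A \<cong> G\<lparr>carrier := generate G (g ` A)\<rparr>"
    by (rule is_isoI)
  then show ?thesis
    using group.iso_sym[OF group_free_group] by blast
qed

end

text \<open>Every letter \<open>x\<close>, inverse letters included, maps the complement of \<open>K (inv_letter x)\<close> into
  \<open>K x\<close>, so a reduced word moves the base point into the set of its first letter.\<close>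

lemma ping_pong:
  assumes g: "g ` A \<subseteq> Bij X"
    and K: "\<And>x. fst x \<in> A \<Longrightarrow> K x \<subseteq> X"
    and disjoint: "\<And>x y. fst x \<in> A \<Longrightarrow> fst y \<in> A \<Longrightarrow> x \<noteq> y \<Longrightarrow> K x \<inter> K y = {}"
    and attract: "\<And>i. i \<in> A \<Longrightarrow> g i ` (X - K (i, False)) \<subseteq> K (i, True)"
    and base: "z \<in> X" "\<And>x. fst x \<in> A \<Longrightarrow> z \<notin> K x"
  shows "BijGroup X\<lparr>carrier := generate (BijGroup X) (g ` A)\<rparr> \<cong> free_group A"
proof -
  let ?G = "BijGroup X"
  interpret group ?G by (rule group_BijGroup)
  have carrier: "carrier ?G = Bij X"
    and mult: "\<And>f h x. f \<in> Bij X \<Longrightarrow> h \<in> Bij X \<Longrightarrow> x \<in> X \<Longrightarrow> (f \<otimes>\<^bsub>?G\<^esub> h) x = f (h x)"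
    and one: "\<And>x. x \<in> X \<Longrightarrow> \<one>\<^bsub>?G\<^esub> x = x"
    by (simp_all add: BijGroup_def compose_def)
  have g': "g ` A \<subseteq> carrier ?G" using g by (simp add: carrier)
  have letter: "letter_value ?G g x y \<in> K x"
    if x: "fst x \<in> A" and y: "y \<in> X" "y \<notin> K (inv_letter x)" for x y
  proof (cases x)
    case (Pair i b)
    then have i: "i \<in> A" using x by simp
    show ?thesis
    proof (cases b)
      case True
      then show ?thesis
        using attract[OF i] y by (auto simp: Pair letter_value_def inv_letter_def)
    next
      case False
      have f: "g i \<in> Bij X" using g i by blast
      then have inv: "inv\<^bsub>?G\<^esub> (g i) = (\<lambda>y\<in>X. inv_into X (g i) y)"
        by (rule inv_BijGroup)
      have bij: "bij_betw (g i) X X" using f by (simp add: Bij_def)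
      let ?u = "inv_into X (g i) y"
      have u: "?u \<in> X" "g i ?u = y"
        using bij y by (auto simp: bij_betw_def inv_into_into f_inv_into_f)
      \<comment> \<open>Contraposition of \<open>attract\<close>: outside
        \<open>K (i, False)\<close>, the preimage of \<open>y\<close> would force \<open>y\<close>
        into \<open>K (i, True)\<close>, which is excluded.\<close>
      have "?u \<in> K (i, False)"
        using attract[OF i] u y False by (auto simp: Pair inv_letter_def)
      then show ?thesis
        using False y by (simp add: Pair letter_value_def inv)
    qed
  qed
  have word: "word_value ?G g w z \<in> K (hd w)"
    if "reduced w" "fst ` set w \<subseteq> A" "w \<noteq> []" for w
    using that
  proof (induction w)
    case (Cons x w)
    have x: "fst x \<in> A" using Cons by simp
    have mem: "word_value ?G g w \<in> Bij X" "letter_value ?G g x \<in> Bij X"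
      unfolding carrier[symmetric]
      using Cons.prems by (auto intro!: word_value_closed[OF g'] letter_value_closed[OF g'])
    then have "word_value ?G g (x # w) z = letter_value ?G g x (word_value ?G g w z)"
      using base by (simp add: mult)
    moreover have "word_value ?G g w z \<in> X \<and> word_value ?G g w z \<notin> K (inv_letter x)"
    proof (cases w)
      case Nil
      then show ?thesis
        using base x by (simp add: one inv_letter_def)
    next
      case (Cons y v)
      then have "y \<noteq> inv_letter x" using Cons.prems by (simp add: reduced_def)
      moreover have "word_value ?G g w z \<in> K y"
        using Cons Cons.IH Cons.prems reduced_ConsD[of x w] by simp
      moreover have "fst y \<in> A" "fst (inv_letter x) \<in> A"
        using Cons Cons.prems x by (auto simp: inv_letter_def)
      ultimately show ?thesis using disjoint[of y "inv_letter x"] K by blast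
    qed
    ultimately show ?case using letter[OF x] by simp
  qed simp
  show ?thesis
  proof (rule generate_iso_free_group[OF g'])
    fix w assume w: "w \<in> reduced_words A" "w \<noteq> []"
    then have "word_value ?G g w z \<in> K (hd w)" "fst (hd w) \<in> A"
      using word[of w] by (auto simp: reduced_words_def)
    moreover have "\<one>\<^bsub>?G\<^esub> z = z" using base by (simp add: one)
    ultimately show "word_value ?G g w \<noteq> \<one>\<^bsub>?G\<^esub>"
      using base(2) by metis
  qed
qed

section \<open>Free pairs\<close>

text \<open>At each turn all leaves of the child off the path are charged in full, so only the child
  on the path needs the induction hypothesis.\<close>

lemma leaf_intervals_outside:
  "a < b \<Longrightarrow>
    length (filter (\<lambda>I. \<not> between I \<subseteq> address_interval a b p) (leaf_intervals a b t)) \<le> outside p t"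
proof (induction p arbitrary: a b t)
  case Nil
  have "between I \<subseteq> {a..<b}" if "I \<in> set (leaf_intervals a b t)" for I
    using that leaf_intervals_subset[OF Nil, of _ t]
    by (metis Suc_eq_plus1 in_set_conv_nth length_leaf_intervals less_Suc_eq_le)
  then show ?case by (simp add: filter_empty_conv)
next
  case (Cons x p)
  let ?m = "(a + b) / 2"
  have m: "a < ?m" "?m < b" using Cons.prems by auto
  show ?case
  proof (cases t)
    case Leaf
    then show ?thesis by simp
  next
    case (Node l u r)
    show ?thesis
    proof (cases x)
      case True
      have "length (filter P (leaf_intervals a ?m l)) \<le> size l + 1" for P
        using length_filter_le[of P "leaf_intervals a ?m l"] by (simp add: length_leaf_intervals)
      from add_mono[OF this Cons.IH[OF m(2), of r]] show ?thesis
        by (simp add: Node True)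
    next
      case False
      have "length (filter P (leaf_intervals ?m b r)) \<le> size r + 1" for P
        using length_filter_le[of P "leaf_intervals ?m b r"] by (simp add: length_leaf_intervals)
      from add_mono[OF Cons.IH[OF m(1), of l] this] show ?thesis
        by (simp add: Node False add.assoc)
    qed
  qed
qed

definition far_leaves :: "bool list \<Rightarrow> unit tree \<Rightarrow> nat set" where
  "far_leaves p t = {i. i \<le> size t \<and> \<not> between (leaf_interval t i) \<subseteq> address_interval 0 1 p}"

lemma card_far_leaves: "card (far_leaves p t) \<le> outside p t"
  using leaf_intervals_outside[of 0 1 p t]
  by (simp add: length_filter_conv_card length_leaf_intervals far_leaves_def leaf_interval_def
      less_Suc_eq_le)

text \<open>Here \<open>p\<close> is the repelling and \<open>q\<close> the attracting address:
  leaves sticking out of the interval of \<open>p\<close> must go to leaves inside that of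
  \<open>q\<close>.\<close>

definition attracting :: "bool list \<Rightarrow> bool list \<Rightarrow> nat \<Rightarrow> nat \<Rightarrow> diagram set" where
  "attracting p q M n = (SIGMA S:concentrated p M n. SIGMA R:concentrated q M n.
     {f. f permutes {0..n} \<and> f ` far_leaves p S \<inter> far_leaves q R = {}})"

lemma attracting_subset: "attracting p q M n \<subseteq> diagrams n"
  by (auto simp: attracting_def diagrams_def concentrated_def trees_def)

text \<open>A point outside the interval of \<open>p\<close> lies in a leaf interval not contained
  in it, hence in a far leaf of the source.\<close>

lemma attracting_image:
  assumes "D \<in> attracting p q M n"
  shows "diagram_map D ` ({0..<1} - address_interval 0 1 p) \<subseteq> address_interval 0 1 q"
proof
  fix y assume "y \<in> diagram_map D ` ({0..<1} - address_interval 0 1 p)"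
  then obtain x where x: "x \<in> {0..<1}" "x \<notin> address_interval 0 1 p" "y = diagram_map D x"
    by blast
  obtain S R f where D: "D = (S, R, f)" by (cases D)
  then have size: "size S = n" "size R = n" and f: "f permutes {0..n}"
    and far: "f ` far_leaves p S \<inter> far_leaves q R = {}"
    using assms by (auto simp: attracting_def concentrated_def trees_def)
  obtain i where i: "i \<le> n" "x \<in> between (leaf_interval S i)"
    using leaf_interval_ex1[OF x(1), of S] size by auto
  then have fi: "f i \<le> n" using permutes_in_image[OF f, of i] by simp
  have "i \<in> far_leaves p S" using i x(2) size by (auto simp: far_leaves_def)
  then have "f i \<notin> far_leaves q R" using far by blast
  then have "between (leaf_interval R (f i)) \<subseteq> address_interval 0 1 q"
    using fi size by (simp add: far_leaves_def)
  moreover have "y \<in> between (leaf_interval R (f i))"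
    using diagram_map_eq[of i S x R f] i size fi x(3) D
      stretch_between[OF lower_less_upper, of "f i" R x "leaf_interval S i"] by simp
  ultimately show "y \<in> address_interval 0 1 q" by blast
qed

section \<open>Generated subgroups of \<open>V\<close> and ping-pong for a pair of diagrams\<close>

lemma inv_diagram_map:
  assumes "(S, R, p) \<in> diagrams n"
  shows "inv\<^bsub>BijGroup {0..<1}\<^esub> (diagram_map (S, R, p)) = diagram_map (R, S, inv_into UNIV p)"
proof -
  let ?f = "diagram_map (S, R, p)" and ?g = "diagram_map (R, S, inv_into UNIV p)"
  have f: "?f \<in> Bij {0..<1}" and g: "?g \<in> Bij {0..<1}"
    using diagram_map_Bij assms diagrams_inverse by blast+
  have "compose {0..<1} ?g ?f = (\<lambda>x\<in>{0..<1}. x)"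
    using diagram_map_inverse(2)[OF assms] by (auto simp: compose_def restrict_def)
  then have "?g \<otimes>\<^bsub>BijGroup {0..<1}\<^esub> ?f = \<one>\<^bsub>BijGroup {0..<1}\<^esub>"
    using f g by (simp add: BijGroup_def)
  then show ?thesis
    using f g by (intro group.inv_equality[OF group_BijGroup]) (simp_all add: BijGroup_def)
qed

text \<open>This lets ping-pong run among all bijections. An inverse is a description ranging over
  the carrier, so the two structures agree on it because the reversed diagram puts the inverse into
  \<open>V\<close>.\<close>

lemma generate_thompson_V:
  assumes H: "H \<subseteq> diagram_map ` (\<Union>n. diagrams n)"
  shows "generate thompson_V H = generate (BijGroup {0..<1}) H"
proof -
  let ?B = "BijGroup {0..<1 :: real}"
  interpret B: group ?B by (rule group_BijGroup)
  have V: "thompson_V_set \<subseteq> carrier ?B"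
    by (auto simp: thompson_V_set_def BijGroup_def)
  have [simp]: "x \<otimes>\<^bsub>thompson_V\<^esub> y = x \<otimes>\<^bsub>?B\<^esub> y" "\<one>\<^bsub>thompson_V\<^esub> = \<one>\<^bsub>?B\<^esub>"
    "carrier thompson_V = thompson_V_set" for x y
    by (simp_all add: thompson_V_def)
  have inv: "inv\<^bsub>thompson_V\<^esub> h = inv\<^bsub>?B\<^esub> h" if "h \<in> H" for h
  proof -
    from that H obtain S R p n where D: "h = diagram_map (S, R, p)" "(S, R, p) \<in> diagrams n"
      by fastforce
    have h: "h \<in> carrier ?B"
      using diagram_map_thompson_V[OF D(2)] V D(1) by blast
    have "inv\<^bsub>?B\<^esub> h \<in> thompson_V_set"
      using inv_diagram_map[OF D(2)] diagram_map_thompson_V[OF diagrams_inverse[OF D(2)]] D(1) by simp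
    then show ?thesis
      unfolding m_inv_def[of thompson_V] using h V
      by (intro the_equality) (auto simp: B.inv_equality[symmetric] intro: B.inv_equality)
  qed
  show ?thesis
  proof (intro equalityI subsetI)
    fix x assume "x \<in> generate thompson_V H"
    then show "x \<in> generate ?B H"
      by induction (auto simp: inv intro: generate.intros)
  next
    fix x assume "x \<in> generate ?B H"
    then show "x \<in> generate thompson_V H"
    proof induction
      case one
      then show ?case using generate.one[of thompson_V H] by simp
    next
      case (incl h)
      then show ?case by (rule generate.incl)
    next
      case (inv h)
      then show ?case using generate.inv[of h H thompson_V] \<open>\<And>h. h \<in> H \<Longrightarrow> inv\<^bsub>thompson_V\<^esub> h = _ h\<close> by simp
    next
      case (eng y z)
      then show ?case using generate.eng[of y thompson_V H z] by simp
    qed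
  qed
qed

lemma card_addresses: "finite {p :: bool list. length p = d}" "card {p :: bool list. length p = d} = 2 ^ d"
  using finite_lists_length_eq[of "UNIV :: bool set" d] card_lists_length_eq[of "UNIV :: bool set" d]
  by simp_all

lemma attracting_free_pairs:
  assumes len: "length p1 = d" "length p2 = d" "length p3 = d" "length p4 = d"
    and dist: "distinct [p1, p2, p3, p4]" and d: "d \<ge> 3"
    and D1: "D1 \<in> attracting p1 p2 M n" and D2: "D2 \<in> attracting p3 p4 M n"
  shows "(D1, D2) \<in> free_pairs"
proof -
  have D: "D1 \<in> diagrams n" "D2 \<in> diagrams n"
    using D1 D2 attracting_subset by blast+
  define g where "g i = (if i = 0 then diagram_map D1 else diagram_map D2)" for i :: nat
  \<comment> \<open>Each generator gets its attracting address at the letter \<open>True\<close> and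
    its repelling one at \<open>False\<close>; the default \<open>p4\<close> is meant for
    \<open>(1, True)\<close>.\<close>
  define address where
    "address x = (if x = (0, False) then p1 else if x = (0, True) then p2
      else if x = (1, False) then p3 else p4)" for x :: "nat \<times> bool"
  define K where "K x = address_interval 0 1 (address x)" for x
  have address: "length (address x) = d" for x
    by (simp add: address_def len)
  have inj: "x = y" if "fst x \<in> {0, 1}" "fst y \<in> {0, 1}" "address x = address y" for x y
    using that dist by (cases x; cases y) (auto simp: address_def split: if_splits)
  \<comment> \<open>From \<open>d \<ge> 3\<close> there are at least eight addresses; a fifth one
    supplies the base point outside the four intervals.\<close>
  have "(2::nat) ^ 3 \<le> 2 ^ d"
    using d by (intro power_increasing) auto
  moreover have "card {p1, p2, p3, p4} = 4" using dist by simp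
  ultimately have "\<not> {p. length p = d} \<subseteq> {p1, p2, p3, p4}"
    using card_mono[of "{p1, p2, p3, p4}" "{p. length p = d}"] card_addresses[of d] by auto
  then obtain r where r: "length r = d" "r \<notin> {p1, p2, p3, p4}" by blast
  obtain z where z: "z \<in> address_interval 0 1 r"
    using address_interval_nonempty[of 0 1 r] by auto
  have gimg: "g ` {0, 1} = {diagram_map D1, diagram_map D2}"
    by (auto simp: g_def)
  have "BijGroup {0..<1}\<lparr>carrier := generate (BijGroup {0..<1}) (g ` {0, 1})\<rparr> \<cong> free_group {0 :: nat, 1}"
  proof (rule ping_pong[where K = K and z = z])
    show "g ` {0, 1} \<subseteq> Bij {0..<1}"
      unfolding gimg using diagram_map_Bij D by blast
    show "K x \<subseteq> {0..<1}" for x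
      unfolding K_def by (rule address_interval_subset) simp
    show "K x \<inter> K y = {}" if "fst x \<in> {0, 1}" "fst y \<in> {0, 1}" "x \<noteq> y" for x y
      unfolding K_def using inj[OF that(1,2)] that(3)
      by (intro address_interval_disjoint) (auto simp: address)
    show "g i ` ({0..<1} - K (i, False)) \<subseteq> K (i, True)" if "i \<in> {0, 1}" for i
      using that attracting_image[OF D1] attracting_image[OF D2]
      by (auto simp: g_def K_def address_def)
    show "z \<in> {0..<1}"
      using z address_interval_subset[of 0 1 r] by auto
    show "z \<notin> K x" for x
    proof -
      have "address x \<noteq> r" using r by (auto simp: address_def)
      then show ?thesis
        using z address_interval_disjoint[of 0 1 r "address x"] address[of x] r(1)
        by (auto simp: K_def)
    qed
  qed
  moreover have "generate thompson_V (g ` {0, 1}) = generate (BijGroup {0..<1}) (g ` {0, 1})"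
    unfolding gimg using D by (intro generate_thompson_V) blast
  ultimately have "generated_subgroup D1 D2 \<cong> free_group {0 :: nat, 1}"
    unfolding generated_subgroup_def gimg by (simp add: thompson_V_def)
  then show ?thesis
    using D by (auto simp: free_pairs_def)
qed


section \<open>The proportion of free pairs\<close>

text \<open>Composing with the transposition of \<open>a\<close> and \<open>b\<close> turns such a
  permutation into one that fixes \<open>a\<close>.\<close>

lemma card_permutes_prescribed_le:
  assumes "finite S" "a \<in> S"
  shows "card {f. f permutes S \<and> f a = b} \<le> fact (card S - 1)"
proof -
  have "{f. f permutes S \<and> f a = b} \<subseteq> (\<lambda>f. transpose a b \<circ> f) ` {f. f permutes (S - {a})}"
  proof
    fix f assume "f \<in> {f. f permutes S \<and> f a = b}"
    then have f: "f permutes insert a (S - {a})" "f a = b"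
      using assms by (auto simp: insert_absorb)
    then have "transpose a b \<circ> f permutes (S - {a})"
      using permutes_insert_lemma[OF f(1)] by simp
    moreover have "f = transpose a b \<circ> (transpose a b \<circ> f)"
      by (simp flip: comp_assoc)
    ultimately show "f \<in> (\<lambda>f. transpose a b \<circ> f) ` {f. f permutes (S - {a})}"
      by blast
  qed
  then have "card {f. f permutes S \<and> f a = b} \<le> card {f. f permutes (S - {a})}"
    using assms by (intro surj_card_le) (auto simp: finite_permutations)
  then show ?thesis
    using assms by (simp add: card_permutations)
qed

text \<open>A union bound over at most \<open>M\<^sup>2\<close> pairs: a random permutation sends a
  given \<open>a\<close> to a given \<open>b\<close> with probability at most
  \<open>1 / card S\<close>.\<close>

lemma card_permutes_avoiding_ge:
  assumes S: "finite S" and A: "A \<subseteq> S" "card A \<le> M" and B: "finite B" "card B \<le> M"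
  shows "fact (card S) * (1 - real M ^ 2 / real (card S))
    \<le> real (card {f. f permutes S \<and> f ` A \<inter> B = {}})"
proof (cases "card S = 0")
  \<comment> \<open>For empty \<open>S\<close> the quotient by \<open>card S\<close> is 0 by
    convention, and the identity is the one permutation.\<close>
  case True
  with S have "S = {}" by simp
  with A show ?thesis by simp
next
  case False
  let ?good = "{f. f permutes S \<and> f ` A \<inter> B = {}}"
  have fin: "finite A" using A S finite_subset by blast
  have "{f. f permutes S} \<subseteq> ?good \<union> (\<Union>(a, b)\<in>A \<times> B. {f. f permutes S \<and> f a = b})"
    by auto
  then have "card {f. f permutes S} \<le> card (?good \<union> (\<Union>(a, b)\<in>A \<times> B. {f. f permutes S \<and> f a = b}))"
    using S by (intro card_mono) (auto simp: finite_permutations intro!: finite_subset[OF _ finite_permutations[OF S]])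
  also have "\<dots> \<le> card ?good + card (\<Union>(a, b)\<in>A \<times> B. {f. f permutes S \<and> f a = b})"
    by (rule card_Un_le)
  also have "card (\<Union>(a, b)\<in>A \<times> B. {f. f permutes S \<and> f a = b})
      \<le> (\<Sum>(a, b)\<in>A \<times> B. card {f. f permutes S \<and> f a = b})"
    using fin B(1) card_UN_le[of "A \<times> B" "\<lambda>(a, b). {f. f permutes S \<and> f a = b}"]
    by (simp add: case_prod_unfold)
  also have "\<dots> \<le> (\<Sum>(a, b)\<in>A \<times> B. fact (card S - 1))"
    using A(1) S by (intro sum_mono) (auto simp del: One_nat_def intro!: card_permutes_prescribed_le)
  also have "\<dots> = card A * card B * fact (card S - 1)"
    by (simp add: card_cartesian_product case_prod_unfold)
  also have "\<dots> \<le> M * M * fact (card S - 1)"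
    using A(2) B(2) by (intro mult_right_mono mult_mono) auto
  finally have "fact (card S) \<le> card ?good + M * M * fact (card S - 1)"
    using S by (simp add: card_permutations)
  then have "real (fact (card S)) \<le> real (card ?good + M * M * fact (card S - 1))"
    by (simp only: of_nat_le_iff)
  then have "fact (card S) \<le> real (card ?good) + real M ^ 2 * fact (card S - 1)"
    by (simp add: power2_eq_square)
  moreover have "(fact (card S) :: real) = real (card S) * fact (card S - 1)"
    using False by (intro fact_reduce) simp
  then have "real M ^ 2 * fact (card S - 1) = fact (card S) * (real M ^ 2 / real (card S))"
    using False by simp
  ultimately show ?thesis
    by (simp add: right_diff_distrib)
qed

lemma finite_concentrated: "finite (concentrated p M n)"
  by (simp add: concentrated_def finite_trees)

lemma finite_diagrams: "finite (diagrams n)"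
  and card_diagrams: "card (diagrams n) = catalan n ^ 2 * fact (n + 1)"
proof -
  have "diagrams n = trees n \<times> trees n \<times> {f. f permutes {0..n}}"
    by (auto simp: diagrams_def trees_def)
  then show "finite (diagrams n)" "card (diagrams n) = catalan n ^ 2 * fact (n + 1)"
    by (simp_all add: finite_trees finite_permutations card_cartesian_product card_permutations
        catalan_def power2_eq_square)
qed

lemma card_attracting_ge:
  "real (card (concentrated p M n)) * real (card (concentrated q M n))
      * (fact (n + 1) * (1 - real M ^ 2 / real (n + 1)))
    \<le> real (card (attracting p q M n))"
proof -
  have far: "far_leaves r t \<subseteq> {0..n}" "card (far_leaves r t) \<le> M" "finite (far_leaves r t)"
    if "t \<in> concentrated r M n" for r t
    using that card_far_leaves[of r t]
    by (auto simp: far_leaves_def concentrated_def trees_def)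
  have fin: "finite {f. f permutes {0..n} \<and> P f}" for P
    by (rule finite_subset[OF _ finite_permutations[of "{0..n}"]]) auto
  have "real (card (attracting p q M n)) = (\<Sum>S\<in>concentrated p M n. \<Sum>R\<in>concentrated q M n.
      real (card {f. f permutes {0..n} \<and> f ` far_leaves p S \<inter> far_leaves q R = {}}))"
    unfolding attracting_def by (simp add: card_SigmaI finite_concentrated fin)
  also have "\<dots> \<ge> (\<Sum>S\<in>concentrated p M n. \<Sum>R\<in>concentrated q M n.
      fact (n + 1) * (1 - real M ^ 2 / real (n + 1)))"
  proof (intro sum_mono)
    fix S R assume "S \<in> concentrated p M n" "R \<in> concentrated q M n"
    then show "fact (n + 1) * (1 - real M ^ 2 / real (n + 1))
        \<le> real (card {f. f permutes {0..n} \<and> f ` far_leaves p S \<inter> far_leaves q R = {}})"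
      using card_permutes_avoiding_ge[of "{0..n}" "far_leaves p S" M "far_leaves q R"] far by simp
  qed
  finally show ?thesis by (simp add: mult.assoc)
qed

text \<open>There are finitely many addresses of length \<open>d\<close>, and
  \<open>concentrated\<close> grows with \<open>M\<close>, so the largest bound serves them
  all.\<close>

lemma concentrated_uniform:
  assumes "c < 1 / 2 ^ d"
  shows "\<exists>M. \<forall>\<^sub>F n in sequentially. \<forall>p\<in>{p. length p = d}.
    c * real (catalan n) \<le> real (card (concentrated p M n))"
proof -
  have "\<forall>p. \<exists>M. length p = d \<longrightarrow>
      (\<forall>\<^sub>F n in sequentially. c * real (catalan n) \<le> real (card (concentrated p M n)))"
    using concentrated_lower_bound[of c] assms by blast
  then obtain N where N: "\<And>p. length p = d \<Longrightarrow>
      \<forall>\<^sub>F n in sequentially. c * real (catalan n) \<le> real (card (concentrated p (N p) n))"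
    by metis
  define M where "M = Max (N ` {p. length p = d})"
  have le: "card (concentrated p (N p) n) \<le> card (concentrated p M n)" if "length p = d" for p n
  proof -
    have "N p \<le> M" unfolding M_def using that card_addresses(1) by (intro Max_ge) auto
    then show ?thesis
      by (intro card_mono finite_concentrated) (auto simp: concentrated_def)
  qed
  have "\<forall>\<^sub>F n in sequentially. c * real (catalan n) \<le> real (card (concentrated p M n))"
    if "length p = d" for p
    using N[OF that] by eventually_elim (use le[OF that] order_trans of_nat_mono in blast)
  then show ?thesis
    using card_addresses(1) by (intro exI[of _ M] eventually_ball_finite) auto
qed

text \<open>Each list of four distinct addresses yields a product set of free pairs. These sets are
  disjoint for large \<open>n\<close>, so their cardinalities add up.\<close>

lemma free_pairs_ratio_ge:
  assumes d: "d \<ge> 3"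
  defines "q \<equiv> 2 ^ d :: real"
  shows "\<forall>\<^sub>F n in sequentially. (1 - 1 / q) ^ 7 * (1 - 2 / q) * (1 - 3 / q)
    \<le> real (card (free_pairs \<inter> Sph2 n)) / real (card (Sph2 n))"
proof -
  have "(2::real) ^ 3 \<le> q" unfolding q_def using d by (intro power_increasing) auto
  then have q: "q \<ge> 8" by simp
  \<comment> \<open>The loss 1 - 1/q occurs once per tree and once per permutation, hence six times
    for two diagrams; the seventh factor comes from \<open>q - 1\<close> in the number of address
    lists. The remaining powers of \<open>q\<close> cancel.\<close>
  define c where "c = (1 - 1 / q) / q"
  have c: "c < 1 / 2 ^ d" "c > 0"
    using q by (simp_all add: c_def q_def[symmetric] field_simps)
  obtain M where M: "\<forall>\<^sub>F n in sequentially. \<forall>p\<in>{p. length p = d}.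
      c * real (catalan n) \<le> real (card (concentrated p M n))"
    using concentrated_uniform[OF c(1)] by blast
  have "(\<lambda>n. 1 - real M ^ 2 / real (n + 1)) \<longlonglongrightarrow> 1" by real_asymp
  then have perm: "\<forall>\<^sub>F n in sequentially. 1 - 1 / q < 1 - real M ^ 2 / real (n + 1)"
    using q by (intro order_tendstoD) auto
  define Q where "Q = {xs :: bool list list. length xs = 4 \<and> distinct xs \<and> set xs \<subseteq> {p. length p = d}}"
  have Q_nth: "length (xs ! i) = d" if "xs \<in> Q" "i < 4" for xs i
  proof -
    have "xs ! i \<in> set xs" using that by (intro nth_mem) (simp add: Q_def)
    then show ?thesis using that(1) by (auto simp: Q_def)
  qed
  have finQ: "finite Q"
    unfolding Q_def
    by (rule finite_subset[OF _ finite_lists_length_eq[OF card_addresses(1)[of d], of 4]]) auto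
  have cardQ: "real (card Q) = q * (q - 1) * (q - 2) * (q - 3)"
  proof -
    have "(2::nat) ^ 3 \<le> 2 ^ d" using d by (intro power_increasing) auto
    then have d4: "(4::nat) \<le> 2 ^ d" by simp
    define m where "m = 2 ^ d - (4::nat)"
    have m: "2 ^ d = m + 4" using d4 by (simp add: m_def)
    have "card Q = \<Prod>{2 ^ d - 4 + 1..2 ^ d}"
      unfolding Q_def using d4 card_lists_distinct_length_eq[OF card_addresses(1)[of d], of 4]
      by (simp add: card_addresses(2))
    also have "\<dots> = \<Prod>{m + 1..m + 4}" using m by simp
    also have "{m + 1..m + 4} = {m + 1, m + 2, m + 3, m + 4}" by auto
    finally have "card Q = (m + 1) * (m + 2) * (m + 3) * (m + 4)" by (simp add: algebra_simps)
    then have "real (card Q) = (real m + 1) * (real m + 2) * (real m + 3) * (real m + 4)"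
      by (simp only: of_nat_mult of_nat_add of_nat_1 of_nat_numeral)
    moreover have "real m = q - 4"
      using arg_cong[OF m, of real] by (simp add: q_def)
    ultimately show ?thesis by (simp add: mult_ac)
  qed
  show ?thesis
    using M perm eventually_gt_at_top[of "2 * M"]
  proof eventually_elim
    case (elim n)
    \<comment> \<open>\<open>w\<close> is the number of diagrams of size \<open>n\<close>.\<close>
    define w where "w = catalan n ^ 2 * (fact (n + 1) :: nat)"
    have w: "w > 0" unfolding w_def using catalan_pos[of n] by simp
    define W where "W xs = attracting (xs ! 0) (xs ! 1) M n \<times> attracting (xs ! 2) (xs ! 3) M n"
      for xs :: "bool list list"
    have attr: "c ^ 2 * (1 - 1 / q) * real w \<le> real (card (attracting p p' M n))"
      if "length p = d" "length p' = d" for p p'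
    proof -
      have "c ^ 2 * (1 - 1 / q) * real w =
          (c * real (catalan n)) * (c * real (catalan n)) * (fact (n + 1) * (1 - 1 / q))"
        by (simp add: w_def power2_eq_square del: fact_Suc)
      also have "\<dots> \<le> real (card (concentrated p M n)) * real (card (concentrated p' M n))
          * (fact (n + 1) * (1 - real M ^ 2 / real (n + 1)))"
        using elim(1,2) that c(2) q by (intro mult_mono) auto
      also have "\<dots> \<le> real (card (attracting p p' M n))"
        by (rule card_attracting_ge)
      finally show ?thesis .
    qed
    \<comment> \<open>Two different addresses would give \<open>n + 1 \<le> 2 * M\<close>, against
      \<open>n > 2 * M\<close>.\<close>
    have unique: "p = p'"
      if "t \<in> concentrated p M n" "t \<in> concentrated p' M n" "length p = d" "length p' = d" for t p p'
      using that outside_add_outside[of p p' t] elim(3)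
      by (fastforce simp: concentrated_def trees_def)
    have disjoint: "W xs \<inter> W ys = {}" if "xs \<in> Q" "ys \<in> Q" "xs \<noteq> ys" for xs ys
    proof (rule ccontr)
      assume "W xs \<inter> W ys \<noteq> {}"
      then have "\<exists>t. t \<in> concentrated (xs ! i) M n \<and> t \<in> concentrated (ys ! i) M n"
        if "i \<in> {0, 1, 2, 3}" for i
        using that by (auto simp: W_def attracting_def)
      moreover have "length (xs ! i) = d" "length (ys ! i) = d" if "i < 4" for i
        using that \<open>xs \<in> Q\<close> \<open>ys \<in> Q\<close> Q_nth by auto
      moreover have "i \<in> {0, 1, 2, 3}" if "i < 4" for i :: nat
        using that by auto
      ultimately have "xs ! i = ys ! i" if "i < 4" for i
        using unique that by metis
      then have "xs = ys"
        using \<open>xs \<in> Q\<close> \<open>ys \<in> Q\<close> by (intro nth_equalityI) (auto simp: Q_def)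
      then show False using that by simp
    qed
    have finW: "finite (W xs)" for xs
      unfolding W_def
      by (intro finite_cartesian_product finite_subset[OF attracting_subset finite_diagrams])
    have "W xs \<subseteq> free_pairs \<inter> Sph2 n" if xs: "xs \<in> Q" for xs
    proof -
      have len: "length xs = 4" "distinct xs" and l: "\<And>i. i < 4 \<Longrightarrow> length (xs ! i) = d"
        using xs Q_nth by (auto simp: Q_def)
      have "distinct [xs ! 0, xs ! 1, xs ! 2, xs ! 3]"
        using len by (simp add: nth_eq_iff_index_eq)
      from attracting_free_pairs[OF l l l l this d] have "(D1, D2) \<in> free_pairs"
        if "D1 \<in> attracting (xs ! 0) (xs ! 1) M n" "D2 \<in> attracting (xs ! 2) (xs ! 3) M n" for D1 D2
        using that by simp
      moreover have "W xs \<subseteq> Sph2 n"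
        unfolding W_def Sph2_def by (intro Sigma_mono attracting_subset)
      ultimately show ?thesis
        unfolding W_def by auto
    qed
    then have "card (\<Union>xs\<in>Q. W xs) \<le> card (free_pairs \<inter> Sph2 n)"
      by (intro card_mono) (auto simp: Sph2_def finite_diagrams)
    moreover have "card (\<Union>xs\<in>Q. W xs) = (\<Sum>xs\<in>Q. card (W xs))"
      using disjoint finW finQ by (intro card_UN_disjoint) auto
    ultimately have le: "(\<Sum>xs\<in>Q. real (card (W xs))) \<le> real (card (free_pairs \<inter> Sph2 n))"
      by (metis of_nat_le_iff of_nat_sum)
    have "(1 - 1 / q) ^ 7 * (1 - 2 / q) * (1 - 3 / q) =
        q * (q - 1) * (q - 2) * (q - 3) * (c ^ 2 * (1 - 1 / q)) ^ 2"
    proof -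
      have e: "q - k = q * (1 - k / q)" for k using q by (simp add: field_simps)
      have "c * q = 1 - 1 / q" using q by (simp add: c_def)
      then have "(1 - 1 / q) ^ 4 = (c * q) ^ 4" by simp
      then show ?thesis
        unfolding e[of 1] e[of 2] e[of 3] by (simp add: power_mult_distrib) algebra
    qed
    then have "(1 - 1 / q) ^ 7 * (1 - 2 / q) * (1 - 3 / q) * real w ^ 2 =
        real (card Q) * (c ^ 2 * (1 - 1 / q) * real w) ^ 2"
      by (simp add: cardQ power_mult_distrib)
    also have "\<dots> = (\<Sum>xs\<in>Q. (c ^ 2 * (1 - 1 / q) * real w) ^ 2)"
      by simp
    also have "\<dots> \<le> (\<Sum>xs\<in>Q. real (card (W xs)))"
    proof (rule sum_mono)
      fix xs assume "xs \<in> Q"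
      then have "length (xs ! i) = d" if "i < 4" for i
        using that Q_nth by blast
      then show "(c ^ 2 * (1 - 1 / q) * real w) ^ 2 \<le> real (card (W xs))"
        unfolding W_def card_cartesian_product power2_eq_square[of "_ * real w"] of_nat_mult
        using q by (intro mult_mono attr) auto
    qed
    also have "\<dots> \<le> real (card (free_pairs \<inter> Sph2 n))" by (rule le)
    finally have "(1 - 1 / q) ^ 7 * (1 - 2 / q) * (1 - 3 / q) * real w ^ 2
        \<le> real (card (free_pairs \<inter> Sph2 n))" .
    moreover have "real (card (Sph2 n)) = real w ^ 2"
      unfolding Sph2_def card_cartesian_product card_diagrams w_def[symmetric]
      by (simp add: power2_eq_square)
    ultimately show ?case
      using w by (simp add: pos_le_divide_eq)
  qed
qed

theorem theorem4:
  shows "\<exists>L::real. L > 0 \<and>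
    (\<lambda>n. real (card (free_pairs \<inter> Sph2 n)) / real (card (Sph2 n))) \<longlonglongrightarrow> L"
proof (intro exI[of _ 1] conjI order_tendstoI)
  fix a :: real assume "a < 1"
  \<comment> \<open>The depth is chosen from \<open>a\<close> alone, before \<open>n\<close>
    grows.\<close>
  have "(\<lambda>d. (1 - 1 / 2 ^ d) ^ 7 * (1 - 2 / 2 ^ d) * (1 - 3 / 2 ^ d) :: real) \<longlonglongrightarrow> 1"
    by real_asymp
  then have "\<forall>\<^sub>F d in sequentially. a < (1 - 1 / 2 ^ d) ^ 7 * (1 - 2 / 2 ^ d) * (1 - 3 / 2 ^ d)"
    using \<open>a < 1\<close> by (rule order_tendstoD)
  then obtain d where d: "d \<ge> 3" "a < (1 - 1 / 2 ^ d) ^ 7 * (1 - 2 / 2 ^ d) * (1 - 3 / 2 ^ d)"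
    unfolding eventually_sequentially by (meson linorder_linear)
  show "\<forall>\<^sub>F n in sequentially. a < real (card (free_pairs \<inter> Sph2 n)) / real (card (Sph2 n))"
    using free_pairs_ratio_ge[OF d(1)] by eventually_elim (use d(2) in linarith)
next
  fix a :: real assume "1 < a"
  \<comment> \<open>The trivial upper bound on a proportion is all that the other half of the limit
    requires.\<close>
  have "card (free_pairs \<inter> Sph2 n) \<le> card (Sph2 n)" for n
    by (intro card_mono) (auto simp: Sph2_def finite_diagrams)
  then have "real (card (free_pairs \<inter> Sph2 n)) / real (card (Sph2 n)) \<le> 1" for n
    by (auto simp: divide_le_eq_1)
  then show "\<forall>\<^sub>F n in sequentially. real (card (free_pairs \<inter> Sph2 n)) / real (card (Sph2 n)) < a"
    using \<open>1 < a\<close> by (intro always_eventually allI) (rule le_less_trans)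
qed simp

end
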